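(* Let $H$ and $H'$ be (real) mixed Hodge structures. Then: (i) for every $k\in\mathbf Z$, $\alpha(H\otimes T\langle k\rangle)=\alpha(H)$; (ii) $\alpha(H^* )=\alpha(H)$, where $H^*=\mathrm{Hom}(H,T\langle0\rangle)$ is the dual mixed Hodge structure; (iii) $\alpha(H\oplus H')=\alpha(H)+\alpha(H')$; (iv) $\alpha(H\otimes H')=\dim(H')\,\alpha(H)+\dim(H)\,\alpha(H')$.
   Context: A real mixed Hodge structure $H$ is a finite-dimensional real vector space $H_{\mathbf R}$ with an increasing exhaustive filtration $W_\bullet$ and a decreasing exhaustive filtration $F^\bullet$ on $H_{\mathbf C}=H_{\mathbf R}\otimes\mathbf C$, with conjugate $\overline F^\bullet$, such that $Gr_F^pGr_{\overline F}^qGr^W_nH_{\mathbf C}=0$ if $p+q\ne n$. Direct sums, tensor products and duals carry the usual filtrations. $T\langle k\rangle$ is the Tate Hodge structure of rank $1$ and type $(-k,-k)$. $\dim H=\dim_{\mathbf C}H_{\mathbf C}$. The level of $\mathbf R$-splitting of $H$ is $\alpha(H)=\frac12\sum_{p,q}(p+q)^2(h_H^{p,q}-s_H^{p,q})$, where $h_H^{p,q}=\dim_{\mathbf C}Gr_{\overline F}^qGr_F^pGr^W_{p+q}H_{\mathbf C}$ and $s_H^{p,q}=\dim_{\mathbf C}Gr_F^pGr_{\overline F}^qH_{\mathbf C}$. *)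

theory Defs
  imports "HOL-Analysis.Analysis" "HOL-Analysis.Finite_Function_Topology" "HOL-Library.Groups_Big_Fun"
begin

subsection \<open>Complexification of a real vector space\<close>

text \<open>
  The complexification of \<open>V\<close> is \<open>V \<oplus> i V\<close>, a pair \<open>(x, y)\<close> standing for \<open>x + i y\<close>.
\<close>

type_synonym 'a complexified = "'a \<times> 'a"

definition cscale :: "complex \<Rightarrow> 'a::real_vector complexified \<Rightarrow> 'a complexified" where
  "cscale c z = (Re c *\<^sub>R fst z - Im c *\<^sub>R snd z, Im c *\<^sub>R fst z + Re c *\<^sub>R snd z)"

global_interpretation cplx: vector_space "cscale :: complex \<Rightarrow> 'a::real_vector complexified \<Rightarrow> _"
  defines csubspace = cplx.subspace
    and cspan = cplx.span
    and cdependent = cplx.dependent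
    and cdim = cplx.dim
  by unfold_locales (simp_all add: cscale_def algebra_simps)

definition cconj :: "'a::real_vector complexified \<Rightarrow> 'a complexified" where
  "cconj z = (fst z, - snd z)"

definition complexify :: "'a set \<Rightarrow> 'a complexified set" where
  "complexify S = S \<times> S"


subsection \<open>Graded pieces as subquotients\<close>

text \<open>
  A pair \<open>(A, B)\<close> of subspaces with \<open>B \<subseteq> A\<close> stands for the subquotient \<open>A / B\<close>. A filtration
  \<open>F\<close> of the ambient space induces on \<open>A / B\<close> the filtration \<open>(F\<^sup>p \<inter> A + B) / B\<close>; its graded
  piece is again a subquotient of the ambient space, so that graded functors can be iterated.
\<close>

type_synonym 'v subquotient = "'v set \<times> 'v set"

definition whole_space :: "'v::ab_group_add subquotient" where
  "whole_space = (UNIV, {0})"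

definition gr_dec :: "(int \<Rightarrow> 'v::ab_group_add set) \<Rightarrow> int \<Rightarrow> 'v subquotient \<Rightarrow> 'v subquotient" where
  "gr_dec F p Q = ((F p \<inter> fst Q) + snd Q, (F (p + 1) \<inter> fst Q) + snd Q)"

definition gr_inc :: "(int \<Rightarrow> 'v::ab_group_add set) \<Rightarrow> int \<Rightarrow> 'v subquotient \<Rightarrow> 'v subquotient" where
  "gr_inc W n Q = ((W n \<inter> fst Q) + snd Q, (W (n - 1) \<inter> fst Q) + snd Q)"

definition zero_subquotient :: "'v subquotient \<Rightarrow> bool" where
  "zero_subquotient Q \<longleftrightarrow> fst Q = snd Q"

definition subquotient_dim :: "'a::real_vector complexified subquotient \<Rightarrow> int" where
  "subquotient_dim Q = int (cdim (fst Q)) - int (cdim (snd Q))"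


subsection \<open>Real mixed Hodge structures\<close>

text \<open>
  The real vector space \<open>H\<^sub>R\<close> is the type \<open>'a\<close>; the weight filtration lives on \<open>H\<^sub>R\<close> and the
  Hodge filtration on its complexification.
\<close>

record 'a filtered_space =
  weight :: "int \<Rightarrow> 'a set"
  hodge :: "int \<Rightarrow> 'a complexified set"

definition weight_C :: "'a filtered_space \<Rightarrow> int \<Rightarrow> 'a complexified set" where
  "weight_C H n = complexify (weight H n)"

definition hodge_conj :: "'a::real_vector filtered_space \<Rightarrow> int \<Rightarrow> 'a complexified set" where
  "hodge_conj H p = cconj ` hodge H p"

text \<open>
  The filtrations of a mixed Hodge structure are finite: they reach both the whole space and \<open>0\<close>.
\<close>

definition mixed_hodge_structure :: "'a::real_vector filtered_space \<Rightarrow> bool" where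
  "mixed_hodge_structure H \<longleftrightarrow>
     (\<exists>B::'a set. finite B \<and> span B = UNIV) \<and>
     (\<forall>n. subspace (weight H n)) \<and> mono (weight H) \<and>
     (\<exists>n. weight H n = {0}) \<and> (\<exists>n. weight H n = UNIV) \<and>
     (\<forall>p. csubspace (hodge H p)) \<and> antimono (hodge H) \<and>
     (\<exists>p. hodge H p = {0}) \<and> (\<exists>p. hodge H p = UNIV) \<and>
     (\<forall>p q n. p + q \<noteq> n \<longrightarrow>
        zero_subquotient
          (gr_dec (hodge H) p (gr_dec (hodge_conj H) q (gr_inc (weight_C H) n whole_space))))"

definition mhs_dim :: "'a::real_vector filtered_space \<Rightarrow> nat" where
  "mhs_dim H = cdim (UNIV :: 'a complexified set)"


subsection \<open>The level of splitting over the reals\<close>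

definition h_number :: "'a::real_vector filtered_space \<Rightarrow> int \<Rightarrow> int \<Rightarrow> int" where
  "h_number H p q = subquotient_dim
     (gr_dec (hodge_conj H) q (gr_dec (hodge H) p (gr_inc (weight_C H) (p + q) whole_space)))"

definition s_number :: "'a::real_vector filtered_space \<Rightarrow> int \<Rightarrow> int \<Rightarrow> int" where
  "s_number H p q = subquotient_dim
     (gr_dec (hodge H) p (gr_dec (hodge_conj H) q whole_space))"

text \<open>
  \<open>Sum_any\<close> sums over all pairs of integers; for a mixed Hodge structure only finitely many
  summands are nonzero.
\<close>

definition splitting_level :: "'a::real_vector filtered_space \<Rightarrow> real" where
  "splitting_level H =
     1 / 2 * Sum_any (\<lambda>(p, q). (of_int (p + q))\<^sup>2 * of_int (h_number H p q - s_number H p q))"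


subsection \<open>Tate structures and direct sums\<close>

definition tate :: "int \<Rightarrow> real filtered_space" where
  "tate k = \<lparr>weight = (\<lambda>n. if n \<ge> - 2 * k then UNIV else {0}),
             hodge = (\<lambda>p. if p \<le> - k then UNIV else {0})\<rparr>"

definition mhs_sum ::
    "'a::real_vector filtered_space \<Rightarrow> 'b::real_vector filtered_space \<Rightarrow> ('a \<times> 'b) filtered_space" where
  "mhs_sum H K =
     \<lparr>weight = (\<lambda>n. weight H n \<times> weight K n),
      hodge = (\<lambda>p. {((x1, y1), (x2, y2)) | x1 x2 y1 y2.
                       (x1, x2) \<in> hodge H p \<and> (y1, y2) \<in> hodge K p})\<rparr>"


subsection \<open>Tensor product of real vector spaces\<close>

text \<open>
  The usual construction: the free real vector space on \<open>'a \<times> 'b\<close>, modulo the subspace spanned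
  by the bilinearity relations.
\<close>

definition tensor_relations :: "('a::real_vector \<times> 'b::real_vector, real) poly_mapping set" where
  "tensor_relations =
     {Poly_Mapping.single (x + x', y) 1
        - (Poly_Mapping.single (x, y) 1 + Poly_Mapping.single (x', y) 1) | x x' y. True} \<union>
     {Poly_Mapping.single (x, y + y') 1
        - (Poly_Mapping.single (x, y) 1 + Poly_Mapping.single (x, y') 1) | x y y'. True} \<union>
     {Poly_Mapping.single (r *\<^sub>R x, y) 1 - r *\<^sub>R Poly_Mapping.single (x, y) 1 | r x y. True} \<union>
     {Poly_Mapping.single (x, r *\<^sub>R y) 1 - r *\<^sub>R Poly_Mapping.single (x, y) 1 | r x y. True}"

definition tensor_equiv ::
    "('a::real_vector \<times> 'b::real_vector, real) poly_mapping \<Rightarrow> ('a \<times> 'b, real) poly_mapping \<Rightarrow> bool" where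
  "tensor_equiv u v \<longleftrightarrow> u - v \<in> span tensor_relations"

lemma equivp_tensor_equiv: "equivp tensor_equiv"
proof (rule equivpI)
  show "reflp tensor_equiv"
    by (simp add: reflp_def tensor_equiv_def span_zero)
  show "symp tensor_equiv"
    by (metis minus_diff_eq span_neg sympI tensor_equiv_def)
  show "transp tensor_equiv"
  proof (rule transpI)
    fix u v w
    assume uv: "tensor_equiv u v" and vw: "tensor_equiv v w"
    have "(u - v) + (v - w) \<in> span tensor_relations"
      using uv vw unfolding tensor_equiv_def by (rule span_add)
    then show "tensor_equiv u w"
      by (simp add: tensor_equiv_def)
  qed
qed

quotient_type (overloaded) ('a, 'b) tensor =
    "('a::real_vector \<times> 'b::real_vector, real) poly_mapping" / tensor_equiv
  by (rule equivp_tensor_equiv)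

instantiation tensor :: (real_vector, real_vector) real_vector
begin

lift_definition zero_tensor :: "('a, 'b) tensor" is 0 .

lift_definition plus_tensor :: "('a, 'b) tensor \<Rightarrow> ('a, 'b) tensor \<Rightarrow> ('a, 'b) tensor" is "(+)"
  unfolding tensor_equiv_def by (metis add_diff_add span_add)

lift_definition uminus_tensor :: "('a, 'b) tensor \<Rightarrow> ('a, 'b) tensor" is uminus
  unfolding tensor_equiv_def by (metis minus_diff_minus span_neg)

lift_definition minus_tensor :: "('a, 'b) tensor \<Rightarrow> ('a, 'b) tensor \<Rightarrow> ('a, 'b) tensor" is "(-)"
  unfolding tensor_equiv_def
  by (metis (no_types, lifting) add_diff_add diff_conv_add_uminus minus_diff_minus span_diff)

lift_definition scaleR_tensor :: "real \<Rightarrow> ('a, 'b) tensor \<Rightarrow> ('a, 'b) tensor" is scaleR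
  unfolding tensor_equiv_def by (metis scaleR_diff_right span_scale)

instance
  by standard
    (transfer; simp add: tensor_equiv_def span_zero algebra_simps)+

end

lift_definition tensor_mk :: "'a::real_vector \<Rightarrow> 'b::real_vector \<Rightarrow> ('a, 'b) tensor"
  is "\<lambda>x y. Poly_Mapping.single (x, y) 1" .

lemma bilinear_tensor_mk: "bilinear tensor_mk"
proof -
  have rel: "tensor_equiv u v" if "u - v \<in> tensor_relations"
    for u v :: "('a \<times> 'b, real) poly_mapping"
    using that by (simp add: tensor_equiv_def span_base)
  have "tensor_mk (x + x') y = tensor_mk x y + tensor_mk x' y" for x x' :: 'a and y :: 'b
    by transfer (rule rel, unfold tensor_relations_def, blast)
  moreover have "tensor_mk x (y + y') = tensor_mk x y + tensor_mk x y'" for x :: 'a and y y' :: 'b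
    by transfer (rule rel, unfold tensor_relations_def, blast)
  moreover have "tensor_mk (r *\<^sub>R x) y = r *\<^sub>R tensor_mk x y" for r and x :: 'a and y :: 'b
    by transfer (rule rel, unfold tensor_relations_def, blast)
  moreover have "tensor_mk x (r *\<^sub>R y) = r *\<^sub>R tensor_mk x y" for r and x :: 'a and y :: 'b
    by transfer (rule rel, unfold tensor_relations_def, blast)
  ultimately show ?thesis
    by (simp add: bilinear_def linear_iff)
qed

text \<open>The complex bilinear extension of \<open>tensor_mk\<close> to the complexifications.\<close>

definition ctensor_mk ::
    "'a::real_vector complexified \<Rightarrow> 'b::real_vector complexified \<Rightarrow> ('a, 'b) tensor complexified" where
  "ctensor_mk z w =
     (tensor_mk (fst z) (fst w) - tensor_mk (snd z) (snd w),
      tensor_mk (fst z) (snd w) + tensor_mk (snd z) (fst w))"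

definition mhs_tensor ::
    "'a::real_vector filtered_space \<Rightarrow> 'b::real_vector filtered_space \<Rightarrow> ('a, 'b) tensor filtered_space" where
  "mhs_tensor H K =
     \<lparr>weight = (\<lambda>n. span {tensor_mk x y | x y i j. i + j = n \<and> x \<in> weight H i \<and> y \<in> weight K j}),
      hodge = (\<lambda>p. cspan {ctensor_mk z w | z w i j. i + j = p \<and> z \<in> hodge H i \<and> w \<in> hodge K j})\<rparr>"


subsection \<open>Internal Hom and dual\<close>

typedef (overloaded) ('a, 'b) hom = "{f :: 'a::real_vector \<Rightarrow> 'b::real_vector. linear f}"
  morphisms hom_apply Abs_hom
  by (rule exI[of _ "\<lambda>_. 0"]) (simp add: linear_iff)

setup_lifting type_definition_hom

instantiation hom :: (real_vector, real_vector) real_vector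
begin

lift_definition zero_hom :: "('a, 'b) hom" is "\<lambda>_. 0"
  by (simp add: linear_iff)

lift_definition plus_hom :: "('a, 'b) hom \<Rightarrow> ('a, 'b) hom \<Rightarrow> ('a, 'b) hom" is "\<lambda>f g x. f x + g x"
  by (simp add: linear_iff algebra_simps)

lift_definition uminus_hom :: "('a, 'b) hom \<Rightarrow> ('a, 'b) hom" is "\<lambda>f x. - f x"
  by (simp add: linear_iff algebra_simps)

lift_definition minus_hom :: "('a, 'b) hom \<Rightarrow> ('a, 'b) hom \<Rightarrow> ('a, 'b) hom" is "\<lambda>f g x. f x - g x"
  by (simp add: linear_iff algebra_simps)

lift_definition scaleR_hom :: "real \<Rightarrow> ('a, 'b) hom \<Rightarrow> ('a, 'b) hom" is "\<lambda>r f x. r *\<^sub>R f x"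
  by (simp add: linear_iff algebra_simps)

instance
  by standard (transfer; simp add: fun_eq_iff algebra_simps)+

end

text \<open>
  A pair \<open>(f, g)\<close> of real homomorphisms acts on the complexification as the complex linear
  map \<open>f + i g\<close>; every complex linear map has this form.
\<close>

definition chom_apply ::
    "('a::real_vector, 'b::real_vector) hom complexified \<Rightarrow> 'a complexified \<Rightarrow> 'b complexified" where
  "chom_apply \<phi> z =
     (hom_apply (fst \<phi>) (fst z) - hom_apply (snd \<phi>) (snd z),
      hom_apply (fst \<phi>) (snd z) + hom_apply (snd \<phi>) (fst z))"

definition mhs_hom ::
    "'a::real_vector filtered_space \<Rightarrow> 'b::real_vector filtered_space \<Rightarrow> ('a, 'b) hom filtered_space" where
  "mhs_hom H K =
     \<lparr>weight = (\<lambda>n. {f. \<forall>m. \<forall>x\<in>weight H m. hom_apply f x \<in> weight K (m + n)}),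
      hodge = (\<lambda>p. {\<phi>. \<forall>r. \<forall>z\<in>hodge H r. chom_apply \<phi> z \<in> hodge K (r + p)})\<rparr>"

definition mhs_dual :: "'a::real_vector filtered_space \<Rightarrow> ('a, real) hom filtered_space" where
  "mhs_dual H = mhs_hom H (tate 0)"

end

theory Submission
  imports Defs
begin

text \<open>
  Any two filtrations admit a common adapted basis, and on a mixed Hodge structure there are bases
  adapted to \<open>(W, F)\<close> and to \<open>(W, \<close>conjugate of \<open>F)\<close> with the same types that agree modulo lower
  weight. Hence twice the level is the sum of \<open>(p + q)\<^sup>2\<close> over the types of the latter bases minus the
  same sum over the types of a basis adapted to \<open>F\<close> and its conjugate. Such bases pass to tensor
  products, duals and direct sums, where types add up, change sign and are united, respectively.
  Squaring the sum of two types produces cross terms, but these agree on both sides, since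
  \<open>\<Sum>p\<close> and \<open>\<Sum>q\<close> are determined by \<open>F\<close> and its conjugate separately.
\<close>

subsection \<open>Coordinate bases\<close>

text \<open>The obstacle is that \<open>W\<close>, \<open>F\<close> and the conjugate of
  \<open>F\<close> have no common adapted basis in general. If one basis were adapted to all three,
  its types would count both kinds of numbers and the level would be 0. Hence the
  \<open>h_number\<close> side works with a pair of bases linked only modulo lower weight, which is
  all that the graded pieces detect, and the \<open>s_number\<close> side with a further basis that
  ignores \<open>W\<close>. These bases also supply the other invariants in the formulas: each has
  as many elements as the dimension, and each filtration fixes the sum of its own types. The formula
  for the level is proved for arbitrary bases of this kind. So opposedness of the filtrations enters
  exactly once, when the bases are constructed for a given mixed Hodge structure; for sums, duals
  and tensor products they are written down from the old ones.\<close>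

abbreviation clinear_form :: "('a::real_vector complexified \<Rightarrow> complex) \<Rightarrow> bool" where
  "clinear_form \<equiv> module_hom cscale (*)"

lemma clinear_formI:
  assumes "\<And>x y. \<phi> (x + y) = \<phi> x + \<phi> y" "\<And>a x. \<phi> (cscale a x) = a * \<phi> x"
  shows "clinear_form \<phi>"
  by (rule module_hom.intro) (auto intro!: module_hom_axioms.intro assms
      simp: cplx.module_axioms vector_space_over_itself.module_axioms)

text \<open>A finite basis kept together with its dual basis. The forms \<open>c i\<close> turn
  membership in a span into vanishing of coordinates, and they become the basis vectors on passing
  to the dual structure.\<close>

locale coordinates =
  fixes I :: "'i set"
    and b :: "'i \<Rightarrow> 'a::real_vector complexified"
    and c :: "'i \<Rightarrow> 'a complexified \<Rightarrow> complex"
  assumes finite_index: "finite I"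
    and coord_linear: "i \<in> I \<Longrightarrow> clinear_form (c i)"
    and coord_basis: "i \<in> I \<Longrightarrow> j \<in> I \<Longrightarrow> c i (b j) = (if i = j then 1 else 0)"
    and expansion: "(\<Sum>i\<in>I. cscale (c i x) (b i)) = x"

text \<open>The span of the basis vectors with index in \<open>J\<close>, encoded as the common
  zeros of the other coordinate forms. Intersections are then immediate, and \<open>J\<close> can be
  given by a bare inequality between types.\<close>

definition coord_span :: "'i set \<Rightarrow> ('i \<Rightarrow> 'a \<Rightarrow> complex) \<Rightarrow> 'i set \<Rightarrow> 'a set" where
  "coord_span I c J = {x. \<forall>i\<in>I - J. c i x = 0}"

lemma coord_span_Int: "coord_span I c J \<inter> coord_span I c K = coord_span I c (J \<inter> K)"
  by (auto simp: coord_span_def)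

lemma coord_span_mono: "J \<subseteq> K \<Longrightarrow> coord_span I c J \<subseteq> coord_span I c K"
  by (auto simp: coord_span_def)

lemma coord_span_UNIV: "I \<subseteq> J \<Longrightarrow> coord_span I c J = UNIV"
  by (auto simp: coord_span_def)

context coordinates
begin

lemmas coord_add = module_hom.add[OF coord_linear]
lemmas coord_scale = module_hom.scale[OF coord_linear]
lemmas coord_sum = module_hom.sum[OF coord_linear]
lemmas coord_zero = module_hom.zero[OF coord_linear]
lemmas coord_diff = module_hom.diff[OF coord_linear]

lemma subspace_coord_span: "csubspace (coord_span I c J)"
  by (auto simp: cplx.subspace_def coord_span_def coord_add coord_scale coord_zero)

lemma basis_in_coord_span: "i \<in> I \<Longrightarrow> i \<in> J \<Longrightarrow> b i \<in> coord_span I c J"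
  by (auto simp: coord_span_def coord_basis)

lemma coord_span_expansion:
  assumes "x \<in> coord_span I c J"
  shows "x = (\<Sum>i\<in>I \<inter> J. cscale (c i x) (b i))"
proof -
  have "(\<Sum>i\<in>I. cscale (c i x) (b i)) = (\<Sum>i\<in>I \<inter> J. cscale (c i x) (b i))"
    using assms finite_index by (intro sum.mono_neutral_right) (auto simp: coord_span_def)
  then show ?thesis by (simp add: expansion)
qed

lemma coord_span_least:
  assumes "csubspace A" and "\<And>i. i \<in> I \<Longrightarrow> i \<in> J \<Longrightarrow> b i \<in> A"
  shows "coord_span I c J \<subseteq> A"
proof
  fix x assume "x \<in> coord_span I c J"
  then have "x = (\<Sum>i\<in>I \<inter> J. cscale (c i x) (b i))"
    by (rule coord_span_expansion)
  moreover have "(\<Sum>i\<in>I \<inter> J. cscale (c i x) (b i)) \<in> A"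
    using assms by (intro cplx.subspace_sum cplx.subspace_scale) auto
  ultimately show "x \<in> A" by simp
qed

lemma coord_span_eq_span: "coord_span I c J = cspan (b ` (I \<inter> J))"
proof
  show "coord_span I c J \<subseteq> cspan (b ` (I \<inter> J))"
    by (intro coord_span_least cplx.subspace_span cplx.span_base) auto
  show "cspan (b ` (I \<inter> J)) \<subseteq> coord_span I c J"
    by (intro cplx.span_minimal subspace_coord_span) (auto intro: basis_in_coord_span)
qed

lemma inj_on_basis: "inj_on b I"
  by (rule inj_onI) (metis coord_basis zero_neq_one)

lemma independent_basis: "\<not> cdependent (b ` I)"
proof
  assume "cdependent (b ` I)"
  then obtain u j where j: "j \<in> I" "u (b j) \<noteq> 0" and "(\<Sum>v\<in>b ` I. cscale (u v) v) = 0"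
    using finite_index by (auto simp: cplx.dependent_finite)
  then have "(\<Sum>i\<in>I. cscale (u (b i)) (b i)) = 0"
    by (simp add: sum.reindex inj_on_basis)
  then have "0 = c j (\<Sum>i\<in>I. cscale (u (b i)) (b i))"
    using j by (simp add: coord_zero)
  also have "\<dots> = (\<Sum>i\<in>I. if i = j then u (b i) else 0)"
    unfolding coord_sum[OF j(1)] by (rule sum.cong) (auto simp: coord_scale coord_basis j)
  also have "\<dots> = u (b j)"
    using j finite_index by simp
  finally show False using j by simp
qed

lemma dim_coord_span: "cdim (coord_span I c J) = card (I \<inter> J)"
proof -
  have "\<not> cdependent (b ` (I \<inter> J))"
    using independent_basis cplx.dependent_mono by blast
  then have "cdim (coord_span I c J) = card (b ` (I \<inter> J))"
    unfolding coord_span_eq_span by (rule cplx.dim_span_eq_card_independent)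
  also have "\<dots> = card (I \<inter> J)"
    by (rule card_image) (use inj_on_basis in \<open>auto intro: inj_on_subset\<close>)
  finally show ?thesis .
qed

lemma dim_eq_card: "cdim (UNIV :: 'a complexified set) = card I"
  using dim_coord_span[of I] by (simp add: coord_span_UNIV)

text \<open>With \<open>coord_span_Int\<close> this makes the passage from index sets to spans a
  lattice homomorphism. So these spans obey the distributive law, which fails for subspaces in
  general, and iterated graded pieces reduce to set algebra.\<close>

lemma coord_span_plus: "coord_span I c J + coord_span I c K = coord_span I c (J \<union> K)"
proof
  show "coord_span I c J + coord_span I c K \<subseteq> coord_span I c (J \<union> K)"
  proof
    fix x assume "x \<in> coord_span I c J + coord_span I c K"
    then show "x \<in> coord_span I c (J \<union> K)"
      by (elim set_plus_elim) (simp add: coord_span_def coord_add)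
  qed
  show "coord_span I c (J \<union> K) \<subseteq> coord_span I c J + coord_span I c K"
  proof
    fix x assume "x \<in> coord_span I c (J \<union> K)"
    then have "x = (\<Sum>i\<in>I \<inter> (J \<union> K). cscale (c i x) (b i))"
      by (rule coord_span_expansion)
    also have "I \<inter> (J \<union> K) = (I \<inter> J) \<union> (I \<inter> (K - J))" by auto
    also have "(\<Sum>i\<in>\<dots>. cscale (c i x) (b i)) =
        (\<Sum>i\<in>I \<inter> J. cscale (c i x) (b i)) + (\<Sum>i\<in>I \<inter> (K - J). cscale (c i x) (b i))"
      using finite_index by (intro sum.union_disjoint) auto
    also have "\<dots> \<in> coord_span I c J + coord_span I c K"
      by (intro set_plus_intro cplx.subspace_sum cplx.subspace_scale subspace_coord_span
          basis_in_coord_span) auto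
    finally show "x \<in> coord_span I c J + coord_span I c K" .
  qed
qed

lemma subquotient_dim_coord_span:
  assumes "K \<subseteq> J"
  shows "subquotient_dim (coord_span I c J, coord_span I c K) = int (card (I \<inter> (J - K)))"
proof -
  have eq: "I \<inter> (J - K) = (I \<inter> J) - (I \<inter> K)" and sub: "I \<inter> K \<subseteq> I \<inter> J" using assms by auto
  have "card (I \<inter> (J - K)) = card (I \<inter> J) - card (I \<inter> K)"
    unfolding eq using finite_index sub by (intro card_Diff_subset) auto
  moreover have "card (I \<inter> K) \<le> card (I \<inter> J)"
    using sub finite_index by (intro card_mono) auto
  ultimately show ?thesis
    by (simp add: subquotient_dim_def dim_coord_span)
qed

end

lemma coordinates_of_basis:
  assumes "finite I" "inj_on b I" "\<not> cdependent (b ` I)" "cspan (b ` I) = UNIV"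
  shows "coordinates I b (\<lambda>i x. cplx.representation (b ` I) x (b i))"
proof (rule coordinates.intro)
  show "clinear_form (\<lambda>x. cplx.representation (b ` I) x (b i))" for i
    using assms by (intro clinear_formI) (simp_all add: cplx.representation_add cplx.representation_scale)
next
  fix i j assume ij: "i \<in> I" "j \<in> I"
  have "b i = b j \<longleftrightarrow> i = j" using ij assms(2) by (auto simp: inj_on_def)
  then show "cplx.representation (b ` I) (b j) (b i) = (if i = j then 1 else 0)"
    using ij assms by (auto simp: cplx.representation_basis)
next
  fix x
  have "(\<Sum>v\<in>b ` I. cscale (cplx.representation (b ` I) x v) v) = x"
    using assms by (intro cplx.sum_representation_eq) auto
  then show "(\<Sum>i\<in>I. cscale (cplx.representation (b ` I) x (b i)) (b i)) = x"
    using assms by (simp add: sum.reindex)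
qed (use assms in auto)

text \<open>A spanning family indexed by as many elements as the dimension can neither repeat a
  vector nor be dependent. This is how the family \<open>e'\<close> of
  \<open>hodge_bases_exist\<close> is recognised as a basis.\<close>

lemma coordinates_of_spanning:
  fixes b b' :: "'i \<Rightarrow> 'a::real_vector complexified"
  assumes "coordinates I b c" "cspan (b' ` I) = UNIV"
  shows "\<exists>c'. coordinates I b' c'"
proof -
  interpret coordinates I b c by fact
  have fin: "finite (b' ` I)" using finite_index by simp
  have le: "card (b' ` I) \<le> card I" using finite_index by (rule card_image_le)
  have "cdim (UNIV :: 'a complexified set) \<le> card (b' ` I)"
    using cplx.dim_le_card[of UNIV "b' ` I"] fin assms(2) by auto
  then have eq: "card (b' ` I) = card I" using le by (simp add: dim_eq_card)
  then have "inj_on b' I" using finite_index by (rule eq_card_imp_inj_on[rotated])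
  moreover have "\<not> cdependent (b' ` I)"
  proof -
    \<comment> \<open>A maximal independent subset still spans, so it has as many elements as the
      family and must be all of it.\<close>
    obtain B where B: "B \<subseteq> b' ` I" "\<not> cdependent B" "b' ` I \<subseteq> cspan B"
      using cplx.maximal_independent_subset by metis
    then have "cspan B = UNIV"
      using assms(2) cplx.span_minimal[OF B(3) cplx.subspace_span] by auto
    then have "card B = card I"
      using cplx.dim_span_eq_card_independent[OF B(2)] by (simp add: dim_eq_card)
    then have "B = b' ` I"
      using B(1) fin eq by (metis card_subset_eq)
    then show ?thesis using B(2) by simp
  qed
  ultimately show ?thesis
    using coordinates_of_basis finite_index assms(2) by blast
qed

text \<open>The type \<open>f i\<close> is the last index at which the filtration still contains the
  basis vector \<open>i\<close>. One basis adapted to several filtrations turns their sums and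
  intersections into conditions on types.\<close>

definition adapted :: "'i set \<Rightarrow> ('i \<Rightarrow> 'a \<Rightarrow> complex) \<Rightarrow> (int \<Rightarrow> 'a set) \<Rightarrow> ('i \<Rightarrow> int) \<Rightarrow> bool" where
  "adapted I c L f \<longleftrightarrow> (\<forall>p. L p = coord_span I c {i. p \<le> f i})"

lemma adapted_mem: "adapted I c L f \<Longrightarrow> x \<in> L p \<longleftrightarrow> (\<forall>i\<in>I. f i < p \<longrightarrow> c i x = 0)"
  by (auto simp: adapted_def coord_span_def not_le)

lemma (in coordinates) adapted_basis_mem: "adapted I c L f \<Longrightarrow> i \<in> I \<Longrightarrow> p \<le> f i \<Longrightarrow> b i \<in> L p"
  by (auto simp: adapted_def intro: basis_in_coord_span)

lemma (in coordinates) adapted_subspace: "adapted I c L f \<Longrightarrow> csubspace (L p)"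
  by (simp add: adapted_def subspace_coord_span)

lemma adapted_mono: "adapted I c L f \<Longrightarrow> q \<le> p \<Longrightarrow> L p \<subseteq> L q"
  by (auto simp: adapted_mem)

subsection \<open>Hodge numbers and splitting level in coordinates\<close>

text \<open>
  Neither basis need be conjugate to the other: all that the iterated graded pieces see is that
  \<open>e\<close> and \<open>e'\<close> have the same classes in the graded pieces of the weight filtration. Weights are
  negated in order to treat all filtrations as decreasing.
\<close>

definition hodge_bases ::
    "'a::real_vector filtered_space \<Rightarrow> 'i set \<Rightarrow> ('i \<Rightarrow> 'a complexified) \<Rightarrow> ('i \<Rightarrow> 'a complexified \<Rightarrow> complex) \<Rightarrow>
     ('i \<Rightarrow> 'a complexified) \<Rightarrow> ('i \<Rightarrow> 'a complexified \<Rightarrow> complex) \<Rightarrow> ('i \<Rightarrow> int) \<Rightarrow> ('i \<Rightarrow> int) \<Rightarrow> bool" where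
  "hodge_bases H I e c e' c' f g \<longleftrightarrow>
     coordinates I e c \<and> coordinates I e' c' \<and>
     adapted I c (\<lambda>n. weight_C H (- n)) (\<lambda>i. - (f i + g i)) \<and>
     adapted I c' (\<lambda>n. weight_C H (- n)) (\<lambda>i. - (f i + g i)) \<and>
     adapted I c (hodge H) f \<and> adapted I c' (hodge_conj H) g \<and>
     (\<forall>i\<in>I. e i - e' i \<in> weight_C H (f i + g i - 1))"

text \<open>No weight links \<open>r j\<close> to \<open>t j\<close>. The multiplicities of the
  pairs \<open>(r j, t j)\<close> are the numbers \<open>s_number\<close>, whereas those of
  \<open>(f i, g i)\<close> in \<open>hodge_bases\<close> are the numbers
  \<open>h_number\<close>.\<close>

definition split_basis ::
    "'a::real_vector filtered_space \<Rightarrow> 'j set \<Rightarrow> ('j \<Rightarrow> 'a complexified) \<Rightarrow> ('j \<Rightarrow> 'a complexified \<Rightarrow> complex) \<Rightarrow>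
     ('j \<Rightarrow> int) \<Rightarrow> ('j \<Rightarrow> int) \<Rightarrow> bool" where
  "split_basis H J b d r t \<longleftrightarrow>
     coordinates J b d \<and> adapted J d (hodge H) r \<and> adapted J d (hodge_conj H) t"

lemma weight_C_coord_span:
  assumes "adapted I c (\<lambda>n. weight_C H (- n)) (\<lambda>i. - k i)"
  shows "weight_C H n = coord_span I c {i. k i \<le> n}"
proof -
  have "weight_C H (- (- n)) = coord_span I c {i. - n \<le> - k i}"
    using assms unfolding adapted_def by blast
  then show ?thesis by simp
qed

text \<open>Replacing \<open>e i\<close> by \<open>e' i\<close> costs an element of weight below
  \<open>k i\<close>, and everything of weight below \<open>n\<close> belongs to the span anyway.
  Hence any selection \<open>J\<close> of indices inside the layer of weight \<open>n\<close> can be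
  carried from one basis to the other.\<close>

lemma coord_span_layer_subset:
  assumes "coordinates I e c" "coordinates I e' c'"
    and W: "\<And>n. W n = coord_span I c' {i. k i \<le> n}"
    and diff: "\<And>i. i \<in> I \<Longrightarrow> e i - e' i \<in> W (k i - (1::int))"
    and J: "J \<subseteq> {i. k i = n}"
  shows "coord_span I c ({i. k i < n} \<union> J) \<subseteq> coord_span I c' ({i. k i < n} \<union> J)"
proof -
  interpret e: coordinates I e c by fact
  interpret e': coordinates I e' c' by fact
  show ?thesis
  proof (intro e.coord_span_least e'.subspace_coord_span)
    fix i assume i: "i \<in> I" "i \<in> {i. k i < n} \<union> J"
    have "e' i \<in> coord_span I c' ({i. k i < n} \<union> J)"
      using i by (rule e'.basis_in_coord_span)
    moreover have "W (k i - 1) \<subseteq> coord_span I c' ({i. k i < n} \<union> J)"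
      unfolding W using i J by (intro coord_span_mono) auto
    ultimately have "e' i + (e i - e' i) \<in> coord_span I c' ({i. k i < n} \<union> J)"
      using diff[OF i(1)] by (intro cplx.subspace_add e'.subspace_coord_span) auto
    then show "e i \<in> coord_span I c' ({i. k i < n} \<union> J)" by simp
  qed
qed

lemma coord_span_layer_eq:
  assumes "coordinates I e c" "coordinates I e' c'"
    and W: "\<And>n. W n = coord_span I c {i. k i \<le> n}" "\<And>n. W n = coord_span I c' {i. k i \<le> n}"
    and diff: "\<And>i. i \<in> I \<Longrightarrow> e i - e' i \<in> W (k i - (1::int))"
    and J: "J \<subseteq> {i. k i = n}"
  shows "coord_span I c ({i. k i < n} \<union> J) = coord_span I c' ({i. k i < n} \<union> J)"
proof
  show "coord_span I c ({i. k i < n} \<union> J) \<subseteq> coord_span I c' ({i. k i < n} \<union> J)"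
    by (rule coord_span_layer_subset[OF assms(1,2) W(2) diff J])
  have "e' i - e i \<in> W (k i - 1)" if "i \<in> I" for i
    using cplx.subspace_neg[OF coordinates.subspace_coord_span[OF assms(1)] diff[OF that, unfolded W(1)]]
    by (simp add: W(1))
  then show "coord_span I c' ({i. k i < n} \<union> J) \<subseteq> coord_span I c ({i. k i < n} \<union> J)"
    by (intro coord_span_layer_subset[OF assms(2,1) W(1) _ J])
qed

text \<open>The modular law, the part of distributivity that survives for arbitrary subspaces. It
  allows lower weights to be added before or after an intersection.\<close>

lemma set_plus_Int_modular:
  assumes "csubspace X" "csubspace Y" "Y \<subseteq> X"
  shows "(A \<inter> X) + Y = (A + Y) \<inter> X"
proof (intro set_eqI iffI)
  fix x assume "x \<in> (A \<inter> X) + Y"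
  then show "x \<in> (A + Y) \<inter> X"
    using assms by (auto elim!: set_plus_elim intro: set_plus_intro cplx.subspace_add)
next
  fix x assume x: "x \<in> (A + Y) \<inter> X"
  then obtain a y where a: "x = a + y" "a \<in> A" "y \<in> Y" by (auto elim: set_plus_elim)
  then have "x - y \<in> X" using x assms cplx.subspace_diff by blast
  then show "x \<in> (A \<inter> X) + Y" using a by (auto intro: set_plus_intro)
qed

lemma set_plus_zero_subspace: "(A::'a::comm_monoid_add set) + {0} = A"
  by (auto simp: set_plus_def)

text \<open>The steps of \<open>F\<close> are spanned by parts of \<open>e\<close>, those of its
  conjugate by parts of \<open>e'\<close>. Once lower weights are added, the latter are spanned by
  parts of \<open>e\<close> as well, and the iterated graded piece becomes a difference of index
  sets.\<close>

lemma h_number_eq_card: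
  assumes "hodge_bases H I e c e' c' f g"
  shows "h_number H p q = int (card {i \<in> I. f i = p \<and> g i = q})"
proof -
  interpret e: coordinates I e c using assms by (simp add: hodge_bases_def)
  interpret e': coordinates I e' c' using assms by (simp add: hodge_bases_def)
  let ?S = "coord_span I c" and ?S' = "coord_span I c'"
  define k where "k i = f i + g i" for i
  define n where "n = p + q"
  have W: "weight_C H m = ?S {i. k i \<le> m}" and W': "weight_C H m = ?S' {i. k i \<le> m}" for m
    using assms by (auto simp: hodge_bases_def k_def intro!: weight_C_coord_span)
  have F: "hodge H r = ?S {i. r \<le> f i}" and G: "hodge_conj H r = ?S' {i. r \<le> g i}" for r
    using assms by (auto simp: hodge_bases_def adapted_def)
  have diff: "e i - e' i \<in> weight_C H (k i - 1)" if "i \<in> I" for i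
    using assms that by (auto simp: hodge_bases_def k_def)
  \<comment> \<open>\<open>P r\<close> and \<open>Q r\<close> index the preimages, inside weight at
    most \<open>n\<close>, of the two filtrations induced on the graded piece of weight
    \<open>n\<close>.\<close>
  define P where "P r = {i. k i < n} \<union> {i. k i = n \<and> r \<le> f i}" for r
  define Q where "Q r = {i. k i < n} \<union> {i. k i = n \<and> r \<le> g i}" for r
  have wn: "?S {i. k i \<le> n - 1} = ?S {i. k i < n}" "?S' {i. k i \<le> n - 1} = ?S' {i. k i < n}"
    by (auto intro!: arg_cong[of _ _ "coord_span I _"])
  have P: "gr_dec (hodge H) r (gr_inc (weight_C H) n whole_space) = (?S (P r), ?S (P (r + 1)))" for r
  proof -
    have "hodge H r \<inter> weight_C H n + weight_C H (n - 1) = ?S (P r)" for r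
      unfolding F W coord_span_Int e.coord_span_plus
      by (rule arg_cong[of _ _ ?S]) (auto simp: P_def)
    then show ?thesis
      by (simp add: gr_dec_def gr_inc_def whole_space_def set_plus_zero_subspace)
  qed
  have Q: "hodge_conj H r \<inter> weight_C H n + weight_C H (n - 1) = ?S (Q r)" for r
  proof -
    have "hodge_conj H r \<inter> weight_C H n + weight_C H (n - 1) = ?S' (Q r)"
      unfolding G W' coord_span_Int e'.coord_span_plus
      by (rule arg_cong[of _ _ ?S']) (auto simp: Q_def)
    also have "\<dots> = ?S (Q r)"
      unfolding Q_def
      by (rule coord_span_layer_eq[OF e.coordinates_axioms e'.coordinates_axioms W W' diff, symmetric]) auto
    finally show ?thesis .
  qed
  \<comment> \<open>The conjugate filtration itself need not be spanned by vectors of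
    \<open>e\<close>. But weight \<open>n - 1\<close> lies in \<open>?S (P (p + 1))\<close>, so it
    may be inserted as a summand and moved past the intersection by the modular law; then
    \<open>Q\<close> applies.\<close>
  have GP: "hodge_conj H r \<inter> ?S (P p) + ?S (P (p + 1)) = ?S ((Q r \<inter> P p) \<union> P (p + 1))" for r
  proof -
    have PW: "?S (P p) \<subseteq> weight_C H n" unfolding W P_def by (rule coord_span_mono) auto
    have WP: "weight_C H (n - 1) \<subseteq> ?S (P r)" for r unfolding W P_def by (rule coord_span_mono) auto
    have Wsub: "weight_C H (n - 1) + ?S (P (p + 1)) = ?S (P (p + 1))"
      unfolding W e.coord_span_plus by (rule arg_cong[of _ _ ?S]) (auto simp: P_def)
    have "hodge_conj H r \<inter> ?S (P p) + ?S (P (p + 1)) =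
        ((hodge_conj H r \<inter> weight_C H n) \<inter> ?S (P p) + weight_C H (n - 1)) + ?S (P (p + 1))"
      using PW by (simp add: add.assoc Wsub inf_absorb2 Int_assoc)
    also have "(hodge_conj H r \<inter> weight_C H n) \<inter> ?S (P p) + weight_C H (n - 1) = ?S (Q r) \<inter> ?S (P p)"
      unfolding Q[symmetric] using WP
      by (intro set_plus_Int_modular) (auto simp: W e.subspace_coord_span)
    finally show ?thesis by (simp add: coord_span_Int e.coord_span_plus)
  qed
  have "h_number H p q =
      subquotient_dim (?S ((Q q \<inter> P p) \<union> P (p + 1)), ?S ((Q (q + 1) \<inter> P p) \<union> P (p + 1)))"
    unfolding h_number_def n_def[symmetric] P by (simp add: gr_dec_def GP)
  also have "\<dots> = int (card (I \<inter> (((Q q \<inter> P p) \<union> P (p + 1)) - ((Q (q + 1) \<inter> P p) \<union> P (p + 1)))))"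
    by (rule e.subquotient_dim_coord_span) (auto simp: Q_def)
  also have "I \<inter> (((Q q \<inter> P p) \<union> P (p + 1)) - ((Q (q + 1) \<inter> P p) \<union> P (p + 1)))
      = {i \<in> I. f i = p \<and> g i = q}"
    by (auto simp: P_def Q_def k_def n_def)
  finally show ?thesis .
qed

lemma s_number_eq_card:
  assumes "split_basis H J b d r t"
  shows "s_number H p q = int (card {j \<in> J. r j = p \<and> t j = q})"
proof -
  interpret coordinates J b d using assms by (simp add: split_basis_def)
  let ?S = "coord_span J d"
  have F: "hodge H m = ?S {i. m \<le> r i}" and G: "hodge_conj H m = ?S {i. m \<le> t i}" for m
    using assms by (auto simp: split_basis_def adapted_def)
  have "s_number H p q =
      subquotient_dim (?S ({j. p \<le> r j} \<inter> {j. q \<le> t j} \<union> {j. q + 1 \<le> t j}),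
                       ?S ({j. p + 1 \<le> r j} \<inter> {j. q \<le> t j} \<union> {j. q + 1 \<le> t j}))"
    by (simp add: s_number_def gr_dec_def whole_space_def set_plus_zero_subspace
        F G coord_span_Int coord_span_plus)
  also have "\<dots> = int (card (J \<inter> (({j. p \<le> r j} \<inter> {j. q \<le> t j} \<union> {j. q + 1 \<le> t j})
      - ({j. p + 1 \<le> r j} \<inter> {j. q \<le> t j} \<union> {j. q + 1 \<le> t j}))))"
    by (rule subquotient_dim_coord_span) auto
  also have "J \<inter> (({j. p \<le> r j} \<inter> {j. q \<le> t j} \<union> {j. q + 1 \<le> t j})
      - ({j. p + 1 \<le> r j} \<inter> {j. q \<le> t j} \<union> {j. q + 1 \<le> t j})) = {j \<in> J. r j = p \<and> t j = q}"
    by auto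
  finally show ?thesis .
qed

section \<open>From multiplicities of types to the level\<close>

lemma sum_card_fibres:
  fixes \<phi> :: "'b \<Rightarrow> real"
  assumes "finite I" "finite A" "t ` I \<subseteq> A"
  shows "(\<Sum>a\<in>A. \<phi> a * real (card {i \<in> I. t i = a})) = (\<Sum>i\<in>I. \<phi> (t i))"
proof -
  have "(\<Sum>i\<in>I. \<phi> (t i)) = (\<Sum>a\<in>A. \<Sum>i\<in>{i \<in> I. t i = a}. \<phi> (t i))"
    by (rule sum.group[OF assms, symmetric])
  also have "\<dots> = (\<Sum>a\<in>A. \<phi> a * real (card {i \<in> I. t i = a}))"
    by (intro sum.cong) (auto simp: mult.commute)
  finally show ?thesis by simp
qed

lemma splitting_level_eq:
  assumes hb: "hodge_bases H I e c e' c' f g" and sb: "split_basis H J b d r t"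
  shows "splitting_level H =
    1 / 2 * ((\<Sum>i\<in>I. (of_int (f i + g i))\<^sup>2) - (\<Sum>j\<in>J. (of_int (r j + t j))\<^sup>2))"
proof -
  \<comment> \<open>A finite set of types outside of which both multiplicities vanish, so that
    \<open>Sum_any\<close> becomes an ordinary sum.\<close>
  define A where "A = (\<lambda>i. (f i, g i)) ` I \<union> (\<lambda>j. (r j, t j)) ` J"
  define \<phi> :: "int \<times> int \<Rightarrow> real" where "\<phi> a = (of_int (fst a + snd a))\<^sup>2" for a
  have fin: "finite I" "finite J"
    using assms by (auto simp: hodge_bases_def split_basis_def coordinates.finite_index)
  have h: "h_number H p q = int (card {i \<in> I. (f i, g i) = (p, q)})" for p q
    by (simp add: h_number_eq_card[OF hb])
  have s: "s_number H p q = int (card {j \<in> J. (r j, t j) = (p, q)})" for p q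
    by (simp add: s_number_eq_card[OF sb])
  let ?h = "\<lambda>a. real (card {i \<in> I. (f i, g i) = a})" and ?s = "\<lambda>a. real (card {j \<in> J. (r j, t j) = a})"
  have "Sum_any (\<lambda>(p, q). (of_int (p + q))\<^sup>2 * real_of_int (h_number H p q - s_number H p q))
      = Sum_any (\<lambda>a. \<phi> a * (?h a - ?s a))"
    unfolding h s by (rule arg_cong[of _ _ Sum_any]) (auto simp: \<phi>_def)
  also have "\<dots> = (\<Sum>a\<in>A. \<phi> a * (?h a - ?s a))"
  proof (rule Sum_any.expand_superset)
    have "{i \<in> I. (f i, g i) = a} = {}" "{j \<in> J. (r j, t j) = a} = {}" if "a \<notin> A" for a
      using that by (auto simp: A_def)
    then show "{a. \<phi> a * (?h a - ?s a) \<noteq> 0} \<subseteq> A"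
      by (force simp only: card.empty diff_self mult_zero_right mem_Collect_eq)
  qed (simp add: A_def fin)
  also have "\<dots> = (\<Sum>a\<in>A. \<phi> a * ?h a) - (\<Sum>a\<in>A. \<phi> a * ?s a)"
    by (simp add: right_diff_distrib sum_subtractf)
  also have "\<dots> = (\<Sum>i\<in>I. \<phi> (f i, g i)) - (\<Sum>j\<in>J. \<phi> (r j, t j))"
    using fin by (intro arg_cong2[of _ _ _ _ "(-)"] sum_card_fibres) (auto simp: A_def)
  finally show ?thesis
    unfolding splitting_level_def by (simp add: \<phi>_def)
qed

lemma (in coordinates) card_type_eq:
  assumes "adapted I c L f"
  shows "int (card {i \<in> I. f i = p}) = subquotient_dim (L p, L (p + 1))"
proof -
  have "{i \<in> I. f i = p} = I \<inter> ({i. p \<le> f i} - {i. p + 1 \<le> f i})" by auto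
  then show ?thesis
    using assms by (simp add: adapted_def subquotient_dim_coord_span Collect_mono)
qed

text \<open>The multiplicity of a type \<open>p\<close> is the dimension of
  \<open>L p / L (p + 1)\<close>, on which the choice of basis has no influence. This is what makes
  the cross terms of tensor products cancel.\<close>

lemma sum_types_unique:
  assumes "coordinates I b c" "adapted I c L f" "coordinates J b' c'" "adapted J c' L r"
  shows "(\<Sum>i\<in>I. real_of_int (f i)) = (\<Sum>j\<in>J. real_of_int (r j))"
proof -
  have "int (card {i \<in> I. f i = p}) = int (card {j \<in> J. r j = p})" for p
    using coordinates.card_type_eq[OF assms(1,2)] coordinates.card_type_eq[OF assms(3,4)] by simp
  moreover have "finite I" "finite J"
    using assms by (auto simp: coordinates.finite_index)
  ultimately show ?thesis
    using sum_card_fibres[of I "f ` I \<union> r ` J" f real_of_int]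
      sum_card_fibres[of J "f ` I \<union> r ` J" r real_of_int] by simp
qed

subsection \<open>Existence of adapted bases\<close>

text \<open>Greedy choice: run through \<open>T\<close> by increasing \<open>key\<close>, and at
  \<open>t\<close> enlarge the independent set by elements of \<open>Z t\<close> until its span
  contains \<open>Z t\<close>. A set \<open>D\<close> closed downwards under \<open>key\<close>
  either omits the last \<open>t\<close>, so that the induction hypothesis applies, or is
  everything.\<close>

lemma filtered_basis_exists:
  fixes Z :: "'t \<Rightarrow> 'a::real_vector complexified set" and key :: "'t \<Rightarrow> int"
  assumes "finite T"
  shows "\<exists>B lev. \<not> cdependent B \<and> (\<forall>b\<in>B. lev b \<in> T \<and> b \<in> Z (lev b)) \<and>
    (\<forall>D\<subseteq>T. (\<forall>s\<in>D. \<forall>s'\<in>T. key s' \<le> key s \<longrightarrow> s' \<in> D) \<longrightarrow>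
       (\<forall>s\<in>D. Z s \<subseteq> cspan {b \<in> B. lev b \<in> D}))"
  using assms
proof (induction T rule: finite_ranking_induct[where f = key])
  case empty
  show ?case by (intro exI[of _ "{}"]) (auto simp: cplx.independent_empty)
next
  case (insert t T)
  from insert.IH obtain B lev where B: "\<not> cdependent B" "\<forall>b\<in>B. lev b \<in> T \<and> b \<in> Z (lev b)"
    and spans: "\<forall>D\<subseteq>T. (\<forall>s\<in>D. \<forall>s'\<in>T. key s' \<le> key s \<longrightarrow> s' \<in> D) \<longrightarrow>
       (\<forall>s\<in>D. Z s \<subseteq> cspan {b \<in> B. lev b \<in> D})"
    by (elim exE conjE) (rule that)
  obtain B' where B': "B \<subseteq> B'" "B' \<subseteq> B \<union> Z t" "\<not> cdependent B'" "B \<union> Z t \<subseteq> cspan B'"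
    using cplx.maximal_independent_subset_extend[of B "B \<union> Z t"] B(1) by blast
  define lev' where "lev' b = (if b \<in> B then lev b else t)" for b
  have "lev' b \<in> insert t T \<and> b \<in> Z (lev' b)" if "b \<in> B'" for b
    using that B(2) B'(2) by (auto simp: lev'_def)
  moreover have "Z s \<subseteq> cspan {b \<in> B'. lev' b \<in> D}"
    if D: "D \<subseteq> insert t T" "\<forall>s\<in>D. \<forall>s'\<in>insert t T. key s' \<le> key s \<longrightarrow> s' \<in> D" and s: "s \<in> D" for D s
  proof (cases "t \<in> D")
    case False
    then have "Z s \<subseteq> cspan {b \<in> B. lev b \<in> D}"
      using D s by (intro spans[rule_format]) auto
    also have "\<dots> \<subseteq> cspan {b \<in> B'. lev' b \<in> D}"
      using B'(1) by (intro cplx.span_mono) (auto simp: lev'_def)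
    finally show ?thesis .
  next
    case True
    \<comment> \<open>\<open>t\<close> has maximal key, so a downward closed set that contains it
      contains all indices.\<close>
    then have "insert t T \<subseteq> D" using D insert.hyps by auto
    then have eq: "{b \<in> B'. lev' b \<in> D} = B'"
      using B(2) by (auto simp: lev'_def)
    show ?thesis
    proof (cases "s = t")
      case True
      then show ?thesis unfolding eq using B'(4) by simp
    next
      case False
      then have "Z s \<subseteq> cspan {b \<in> B. lev b \<in> T}"
        using D(1) s by (intro spans[rule_format]) auto
      also have "\<dots> \<subseteq> cspan B'"
        using B'(1) by (intro cplx.span_mono) auto
      finally show ?thesis unfolding eq .
    qed
  qed
  ultimately show ?case
    using B'(3) by (intro exI[of _ B'] exI[of _ lev']) blast
qed

lemma dec_int_induct [consumes 1, case_names top step]: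
  fixes a :: int
  assumes "a \<le> m" and "P m" and "\<And>a. a < m \<Longrightarrow> P (a + 1) \<Longrightarrow> P a"
  shows "P a"
  using assms(1)
proof (induction "nat (m - a)" arbitrary: a)
  case 0
  then show ?case using assms(2) by (simp add: order_antisym)
next
  case (Suc k)
  then have "a < m" by linarith
  moreover have "P (a + 1)" using Suc by (intro Suc.hyps) linarith+
  ultimately show ?case by (rule assms(3))
qed

definition finite_filtration :: "(int \<Rightarrow> 'a::real_vector complexified set) \<Rightarrow> bool" where
  "finite_filtration L \<longleftrightarrow>
     (\<forall>p. csubspace (L p)) \<and> antimono L \<and> (\<exists>p. L p = {0}) \<and> (\<exists>p. L p = UNIV)"

lemma finite_filtration_bounds:
  assumes "finite_filtration L"
  obtains lo hi where "\<And>p. p \<le> lo \<Longrightarrow> L p = UNIV" "\<And>p. hi \<le> p \<Longrightarrow> L p = {0}"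
proof -
  obtain l h where lh: "L l = UNIV" "L h = {0}" and anti: "antimono L"
    and sub: "\<And>p. csubspace (L p)"
    using assms by (auto simp: finite_filtration_def)
  show thesis
  proof (rule that[of "min l h" "max l h"])
    fix p assume "p \<le> min l h"
    then have "L l \<subseteq> L p" using antimonoD[OF anti] by simp
    then show "L p = UNIV" using lh by auto
  next
    fix p assume "max l h \<le> p"
    then have "L p \<subseteq> L h" using antimonoD[OF anti] by simp
    then show "L p = {0}" using lh cplx.subspace_0[OF sub] by auto
  qed
qed

text \<open>
  The set \<open>Z (a, b)\<close> prescribes where to look for lifts of a basis of the graded piece of type
  \<open>(a, b)\<close>; the lifts are chosen in lexicographic order of the types.
\<close>

lemma adapted_basis_exists:
  fixes L M :: "int \<Rightarrow> 'a::real_vector complexified set"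
  assumes "finite S" "cspan S = (UNIV :: 'a complexified set)"
    and L: "finite_filtration L" and M: "finite_filtration M"
    and Z: "\<And>a b. Z (a, b) \<subseteq> L a \<inter> M b"
    and step: "\<And>a b x. x \<in> L a \<Longrightarrow> x \<in> M b \<Longrightarrow>
      \<exists>u v w. x = u + v + w \<and> u \<in> L (a + 1) \<and> v \<in> L a \<inter> M (b + 1) \<and> w \<in> Z (a, b)"
  obtains B f g c where "coordinates B (\<lambda>x. x) c" "adapted B c L f" "adapted B c M g"
    "\<And>x. x \<in> B \<Longrightarrow> x \<in> Z (f x, g x)"
proof -
  obtain lo hi where L_lo: "\<And>p. p \<le> lo \<Longrightarrow> L p = UNIV" and L_hi: "\<And>p. hi \<le> p \<Longrightarrow> L p = {0}"
    by (rule finite_filtration_bounds[OF L]) (rule that)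
  obtain lo' hi' where M_lo: "\<And>p. p \<le> lo' \<Longrightarrow> M p = UNIV" and M_hi: "\<And>p. hi' \<le> p \<Longrightarrow> M p = {0}"
    by (rule finite_filtration_bounds[OF M]) (rule that)
  have L_sub: "csubspace (L p)" and M_sub: "csubspace (M p)" for p
    using L M by (auto simp: finite_filtration_def)
  have L_anti: "p \<le> q \<Longrightarrow> L q \<subseteq> L p" and M_anti: "p \<le> q \<Longrightarrow> M q \<subseteq> M p" for p q
    using L M by (auto simp: finite_filtration_def antimono_def)
  define T where "T = {lo..hi} \<times> {lo'..hi'}"
  \<comment> \<open>\<open>N\<close> exceeds every difference of second entries in \<open>T\<close>.
    So the single integer \<open>key\<close> encodes the reversed lexicographic order: larger first
    entries come first, ties are broken by larger second entries.\<close>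
  define N where "N = hi' - lo' + 1"
  define key where "key s = - fst s * N - snd s" for s :: "int \<times> int"
  have "finite T" by (simp add: T_def)
  from filtered_basis_exists[OF this, of Z key]
  obtain B lev where B: "\<not> cdependent B" "\<forall>b\<in>B. lev b \<in> T \<and> b \<in> Z (lev b)"
    and spans: "\<forall>D\<subseteq>T. (\<forall>s\<in>D. \<forall>s'\<in>T. key s' \<le> key s \<longrightarrow> s' \<in> D) \<longrightarrow>
       (\<forall>s\<in>D. Z s \<subseteq> cspan {b \<in> B. lev b \<in> D})"
    by (elim exE conjE) (rule that)
  define f g where "f b = fst (lev b)" and "g b = snd (lev b)" for b
  have BZ: "b \<in> Z (f b, g b)" if "b \<in> B" for b
    using B(2) that by (simp add: f_def g_def)
  then have BL: "b \<in> L a" if "b \<in> B" "a \<le> f b" for a b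
    using that Z L_anti by blast
  have BM: "b \<in> M a" if "b \<in> B" "a \<le> g b" for a b
    using that Z M_anti BZ by blast
  define lex where "lex a b = {x \<in> B. a < f x \<or> (a = f x \<and> b \<le> g x)}" for a b
  have Z_lex: "Z (a, b) \<subseteq> cspan (lex a b)" if "(a, b) \<in> T" for a b
  proof -
    let ?D = "{s \<in> T. a < fst s \<or> (a = fst s \<and> b \<le> snd s)}"
    have key_le: "s' \<in> ?D" if "s \<in> ?D" "s' \<in> T" "key s' \<le> key s" for s s'
    proof -
      obtain r u r' u' where [simp]: "s = (r, u)" "s' = (r', u')" by (cases s, cases s') auto
      have u: "lo' \<le> u" "u \<le> hi'" "lo' \<le> u'" "u' \<le> hi'" using that by (auto simp: T_def)
      have le: "(r - r') * N \<le> u' - u"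
        using that(3) by (simp add: key_def algebra_simps)
      have "r \<le> r'"
      proof (rule ccontr)
        assume "\<not> r \<le> r'"
        then have "1 * N \<le> (r - r') * N"
          using u by (intro mult_right_mono) (auto simp: N_def)
        moreover have "u' - u < N" using u by (simp add: N_def)
        ultimately show False using le by linarith
      qed
      then show ?thesis using that le by auto
    qed
    have "Z (a, b) \<subseteq> cspan {x \<in> B. lev x \<in> ?D}"
    proof (intro spans[rule_format])
      show "(a, b) \<in> ?D" using that by simp
    qed (use key_le in blast)+
    also have "\<dots> \<subseteq> cspan (lex a b)"
      by (intro cplx.span_mono) (auto simp: lex_def f_def g_def)
    finally show ?thesis .
  qed
  \<comment> \<open>Descending induction on \<open>a\<close>, and for fixed \<open>a\<close> on
    \<open>b\<close>. The hypothesis on \<open>Z\<close> splits a vector into a part with larger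
    \<open>a\<close>, a part with larger \<open>b\<close>, and a part in
    \<open>Z (a, b)\<close>.\<close>
  have L_lex: "L a \<inter> M b \<subseteq> cspan (lex a b)" if "lo \<le> a" "lo' \<le> b" for a b
  proof (cases "a \<le> hi")
    case False
    then show ?thesis using L_hi[of a] cplx.span_zero by auto
  next
    case True
    then have "\<forall>b\<ge>lo'. lo \<le> a \<longrightarrow> L a \<inter> M b \<subseteq> cspan (lex a b)"
    proof (induction rule: dec_int_induct)
      case top
      then show ?case using L_hi[of hi] cplx.span_zero by auto
    next
      case (step a)
      show ?case
      proof (intro allI impI)
        fix b assume b: "lo' \<le> b" and a: "lo \<le> a"
        show "L a \<inter> M b \<subseteq> cspan (lex a b)"
        proof (cases "b \<le> hi'")
          case False
          then show ?thesis using M_hi[of b] cplx.span_zero by auto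
        next
          case True
          then have "lo' \<le> b \<longrightarrow> L a \<inter> M b \<subseteq> cspan (lex a b)"
          proof (induction rule: dec_int_induct)
            case top
            then show ?case using M_hi[of hi'] cplx.span_zero by auto
          next
            case (step b)
            show ?case
            proof (intro impI subsetI)
              fix x assume b: "lo' \<le> b" and "x \<in> L a \<inter> M b"
              then obtain u v w where x: "x = u + v + w" and u: "u \<in> L (a + 1)"
                and v: "v \<in> L a \<inter> M (b + 1)" and w: "w \<in> Z (a, b)"
                using assms(6) by blast
              \<comment> \<open>All that is known of \<open>u\<close> with respect to
                \<open>M\<close> is \<open>M lo' = UNIV\<close>. This suffices, since in the
                lexicographic order a larger first entry outweighs any second entry.\<close>
              have "u \<in> cspan (lex (a + 1) lo')"
                using u M_lo[of lo'] \<open>\<forall>b\<ge>lo'. lo \<le> a + 1 \<longrightarrow> L (a + 1) \<inter> M b \<subseteq> cspan (lex (a + 1) b)\<close> a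
                by auto
              moreover have "v \<in> cspan (lex a (b + 1))"
                using v step.IH b by auto
              moreover have "w \<in> cspan (lex a b)"
                using w subsetD[OF Z_lex] a b \<open>a < hi\<close> \<open>b < hi'\<close> by (simp add: T_def)
              moreover have "lex (a + 1) lo' \<subseteq> lex a b" "lex a (b + 1) \<subseteq> lex a b"
                by (auto simp: lex_def)
              ultimately show "x \<in> cspan (lex a b)"
                unfolding x by (meson cplx.span_add cplx.span_mono subsetD)
            qed
          qed
          then show ?thesis using b by simp
        qed
      qed
    qed
    then show ?thesis using that by simp
  qed
  \<comment> \<open>From the lexicographic bound to a bound in both entries: the part
    \<open>y\<close> of first type exactly \<open>a\<close> lies in \<open>M b\<close>, hence so
    does the rest \<open>z = x - y\<close>. As \<open>z\<close> also lies in
    \<open>L (a + 1)\<close>, the induction hypothesis bounds both of its types.\<close>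
  have L_box: "L a \<inter> M b \<subseteq> cspan {x \<in> B. a \<le> f x \<and> b \<le> g x}" if "lo \<le> a" "lo' \<le> b" for a b
  proof (cases "a \<le> hi")
    case False
    then show ?thesis using L_hi[of a] cplx.span_zero by auto
  next
    case True
    then have "lo \<le> a \<longrightarrow> L a \<inter> M b \<subseteq> cspan {x \<in> B. a \<le> f x \<and> b \<le> g x}"
    proof (induction rule: dec_int_induct)
      case top
      then show ?case using L_hi[of hi] cplx.span_zero by auto
    next
      case (step a)
      show ?case
      proof (intro impI subsetI)
        fix x assume a: "lo \<le> a" and x: "x \<in> L a \<inter> M b"
        have "lex a b = {x \<in> B. a = f x \<and> b \<le> g x} \<union> {x \<in> B. a < f x}"
          by (auto simp: lex_def)
        then have "x \<in> cspan ({x \<in> B. a = f x \<and> b \<le> g x} \<union> {x \<in> B. a < f x})"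
          using x L_lex[of a b] a that by auto
        then obtain y z where xyz: "x = y + z" and y: "y \<in> cspan {x \<in> B. a = f x \<and> b \<le> g x}"
          and z: "z \<in> cspan {x \<in> B. a < f x}"
          by (auto simp: cplx.span_Un)
        have "cspan {x \<in> B. a = f x \<and> b \<le> g x} \<subseteq> M b"
          by (intro cplx.span_minimal M_sub) (auto intro: BM)
        then have "y \<in> M b" using y by (rule subsetD)
        then have "z \<in> M b"
          using x xyz cplx.subspace_diff[OF M_sub, of x b y] by simp
        moreover have "cspan {x \<in> B. a < f x} \<subseteq> L (a + 1)"
          by (intro cplx.span_minimal L_sub) (auto intro: BL)
        then have "z \<in> L (a + 1)" using z by (rule subsetD)
        ultimately have "z \<in> cspan {x \<in> B. a + 1 \<le> f x \<and> b \<le> g x}"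
          using step.IH a by auto
        moreover have "{x \<in> B. a + 1 \<le> f x \<and> b \<le> g x} \<subseteq> {x \<in> B. a \<le> f x \<and> b \<le> g x}"
          "{x \<in> B. a = f x \<and> b \<le> g x} \<subseteq> {x \<in> B. a \<le> f x \<and> b \<le> g x}" by auto
        ultimately show "x \<in> cspan {x \<in> B. a \<le> f x \<and> b \<le> g x}"
          unfolding xyz using y by (meson cplx.span_add cplx.span_mono subsetD)
      qed
    qed
    then show ?thesis using that by simp
  qed
  have L_span: "L a = cspan {x \<in> B. a \<le> f x}" for a
  proof
    \<comment> \<open>Below \<open>lo\<close> the filtration is constant, so the index can be raised
      into the range of \<open>L_box\<close>.\<close>
    have "L a = L (max a lo)" by (cases "a \<le> lo") (simp_all add: L_lo max_def)
    then have "L a = L (max a lo) \<inter> M lo'" by (simp add: M_lo)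
    also have "\<dots> \<subseteq> cspan {x \<in> B. max a lo \<le> f x \<and> lo' \<le> g x}" by (rule L_box) auto
    also have "\<dots> \<subseteq> cspan {x \<in> B. a \<le> f x}" by (rule cplx.span_mono) auto
    finally show "L a \<subseteq> cspan {x \<in> B. a \<le> f x}" .
    show "cspan {x \<in> B. a \<le> f x} \<subseteq> L a" using BL by (intro cplx.span_minimal L_sub) auto
  qed
  have M_span: "M a = cspan {x \<in> B. a \<le> g x}" for a
  proof
    have "M a = M (max a lo')" by (cases "a \<le> lo'") (simp_all add: M_lo max_def)
    then have "M a = L lo \<inter> M (max a lo')" by (simp add: L_lo)
    also have "\<dots> \<subseteq> cspan {x \<in> B. lo \<le> f x \<and> max a lo' \<le> g x}" by (rule L_box) auto
    also have "\<dots> \<subseteq> cspan {x \<in> B. a \<le> g x}" by (rule cplx.span_mono) auto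
    finally show "M a \<subseteq> cspan {x \<in> B. a \<le> g x}" .
    show "cspan {x \<in> B. a \<le> g x} \<subseteq> M a" using BM by (intro cplx.span_minimal M_sub) auto
  qed
  have "cspan B = UNIV"
    using L_span[of lo] L_lo[of lo] cplx.span_mono[of "{x \<in> B. lo \<le> f x}" B] by auto
  moreover have "finite B"
    using cplx.independent_span_bound[of S B] assms(1,2) B(1) by simp
  ultimately obtain c where c: "coordinates B (\<lambda>x. x) c"
    using coordinates_of_basis[of B "\<lambda>x. x"] B(1) by auto
  interpret coordinates B "\<lambda>x. x" c by fact
  have "B \<inter> {i. p \<le> h i} = {x \<in> B. p \<le> h x}" for p and h :: "'a complexified \<Rightarrow> int" by auto
  then have "adapted B c L f" "adapted B c M g"
    unfolding adapted_def by (simp_all add: coord_span_eq_span L_span M_span)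
  then show thesis using that c BZ by blast
qed

section \<open>Opposed filtrations on a subquotient\<close>

lemma csubspace_set_plus: "csubspace A \<Longrightarrow> csubspace B \<Longrightarrow> csubspace (A + B)"
  using cplx.subspace_sums[of A B] by (simp add: set_plus_def Bex_def conj_ac)

lemma set_plus_least:
  assumes "csubspace C" "A \<subseteq> C" "B \<subseteq> C"
  shows "A + B \<subseteq> C"
proof
  fix x assume "x \<in> A + B"
  then obtain a b where ab: "x = a + b" "a \<in> A" "b \<in> B" by (rule set_plus_elim)
  then show "x \<in> C"
    using assms(2,3) cplx.subspace_add[OF assms(1), of a b] by (simp add: subset_iff del: split_paired_All)
qed

text \<open>The filtrations induced by \<open>F\<close> and \<open>G\<close> on \<open>A / B\<close>
  are \<open>n\<close>-opposed. It is used with \<open>A / B\<close> the graded piece of weight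
  \<open>n\<close>, where it yields the decomposition into Hodge types.\<close>

locale opposed_filtrations =
  fixes F G :: "int \<Rightarrow> 'a::real_vector complexified set" and A B and n :: int
  assumes F: "finite_filtration F" and G: "finite_filtration G"
    and A: "csubspace A" and B: "csubspace B" and BA: "B \<subseteq> A"
    and opposed: "p + q \<noteq> n \<Longrightarrow> zero_subquotient (gr_dec F p (gr_dec G q (A, B)))"
begin

text \<open>Full preimages in \<open>A\<close> of the filtrations induced on \<open>A / B\<close>.
  They turn assertions about the quotient into assertions about subspaces that contain
  \<open>B\<close>.\<close>

definition "P p = F p \<inter> A + B"
definition "Q q = G q \<inter> A + B"

lemma F_sub: "csubspace (F p)" and G_sub: "csubspace (G p)"
  using F G by (auto simp: finite_filtration_def)

lemma F_anti: "p \<le> q \<Longrightarrow> F q \<subseteq> F p" and G_anti: "p \<le> q \<Longrightarrow> G q \<subseteq> G p"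
  using F G by (auto simp: finite_filtration_def antimono_def)

lemma P_sub: "csubspace (P p)" and Q_sub: "csubspace (Q q)"
  unfolding P_def Q_def
  by (intro csubspace_set_plus cplx.subspace_inter F_sub G_sub A B)+

lemma P_A: "P p \<subseteq> A" and Q_A: "Q q \<subseteq> A"
  unfolding P_def Q_def using BA by (intro set_plus_least A; simp)+

lemma B_P: "B \<subseteq> P p" and B_Q: "B \<subseteq> Q q"
  using set_zero_plus2[of "F p \<inter> A" B] set_zero_plus2[of "G q \<inter> A" B] cplx.subspace_0 F_sub G_sub A
  by (auto simp: P_def Q_def)

lemma F_P: "F p \<inter> A \<subseteq> P p" and G_Q: "G q \<inter> A \<subseteq> Q q"
  unfolding P_def Q_def
  using set_zero_plus2[OF cplx.subspace_0[OF B]] by (simp_all add: add.commute[of _ B])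

text \<open>After subtraction of an element of \<open>B\<close>, the vector lies in
  \<open>F p\<close>. As the bigraded piece vanishes, its class modulo \<open>Q (q + 1)\<close> has
  a representative in \<open>F (p + 1)\<close>, and the difference of the two still lies in
  \<open>F p\<close>.\<close>

lemma Int_step:
  assumes "p + q \<noteq> n" and x: "x \<in> P p \<inter> Q q"
  obtains u v where "x = u + v" "u \<in> P (p + 1) \<inter> Q q" "v \<in> P p \<inter> Q (q + 1)"
proof -
  have eq: "F p \<inter> Q q + Q (q + 1) = F (p + 1) \<inter> Q q + Q (q + 1)"
    using opposed[OF assms(1)] by (simp add: zero_subquotient_def gr_dec_def Q_def)
  obtain a w where a: "x = a + w" "a \<in> F p" "a \<in> A" "w \<in> B"
    using x by (auto simp: P_def elim: set_plus_elim)
  have "x - w \<in> Q q"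
    using x a(4) B_Q by (intro cplx.subspace_diff[OF Q_sub]) auto
  then have "a \<in> F p \<inter> Q q" using a by simp
  then have "a + 0 \<in> F p \<inter> Q q + Q (q + 1)"
    by (intro set_plus_intro cplx.subspace_0[OF Q_sub])
  then obtain a' r where a': "a = a' + r" "a' \<in> F (p + 1)" "a' \<in> Q q" "r \<in> Q (q + 1)"
    unfolding eq by (auto elim: set_plus_elim)
  have "r = a - a'" using a' by simp
  also have "\<dots> \<in> F p"
    using a(2) subsetD[OF F_anti[of p "p + 1"] a'(2)] by (intro cplx.subspace_diff[OF F_sub]) simp_all
  finally have "r \<in> P p" using a'(4) subsetD[OF Q_A] by (intro subsetD[OF F_P]) simp
  then
  have "r + w \<in> P p \<inter> Q (q + 1)"
    using a'(4) subsetD[OF B_P a(4)] subsetD[OF B_Q a(4)]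
    by (simp add: cplx.subspace_add[OF P_sub] cplx.subspace_add[OF Q_sub])
  moreover have "a' \<in> P (p + 1) \<inter> Q q"
    using a' subsetD[OF Q_A a'(3)] subsetD[OF F_P] by simp
  moreover have "x = a' + (r + w)" using a a' by simp
  ultimately show ?thesis using that by blast
qed

text \<open>\<open>Int_step\<close> trades a vector for two vectors with \<open>p\<close> or
  \<open>q\<close> raised, which preserves \<open>p + q > n\<close>. Both filtrations are finite, so
  finally \<open>P p\<close> or \<open>Q q\<close> has shrunk to \<open>B\<close>.\<close>

lemma Int_subset:
  assumes "p + q > n"
  shows "P p \<inter> Q q \<subseteq> B"
proof -
  obtain hi where hi: "\<And>p. hi \<le> p \<Longrightarrow> F p = {0}" by (rule finite_filtration_bounds[OF F]) (rule that)
  obtain hi' where hi': "\<And>p. hi' \<le> p \<Longrightarrow> G p = {0}" by (rule finite_filtration_bounds[OF G]) (rule that)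
  have *: "{0} \<inter> A + B = B" using cplx.subspace_0[OF A] by (simp add: insert_absorb set_plus_def)
  show ?thesis
    using assms
  proof (induction "nat (hi - p) + nat (hi' - q)" arbitrary: p q rule: less_induct)
    case less
    show ?case
    proof (cases "p < hi \<and> q < hi'")
      case False
      then have "P p = B \<or> Q q = B"
        unfolding P_def Q_def by (metis hi hi' * linorder_not_less)
      then show ?thesis by (elim disjE) simp_all
    next
      case True
      then have sub: "P (p + 1) \<inter> Q q \<subseteq> B" "P p \<inter> Q (q + 1) \<subseteq> B"
        using less.prems by (intro less.hyps; simp)+
      show ?thesis
      proof
        fix x assume x: "x \<in> P p \<inter> Q q"
        have "p + q \<noteq> n" using less.prems by simp
        then obtain u v where uv: "x = u + v" "u \<in> P (p + 1) \<inter> Q q" "v \<in> P p \<inter> Q (q + 1)"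
          using x by (rule Int_step)
        show "x \<in> B"
          unfolding uv(1) using uv(2,3) sub by (intro cplx.subspace_add[OF B]) (erule (1) subsetD[rotated])+
      qed
    qed
  qed
qed

text \<open>As long as \<open>p + q < n\<close>, \<open>Int_step\<close> pushes a vector of
  \<open>P p\<close> one step further in \<open>Q\<close>, at the price of a summand in
  \<open>P (p + 1)\<close>. The process stops at \<open>q = n - p\<close>, the only index where the
  bigraded piece may be nonzero.\<close>

lemma decomposition:
  assumes "x \<in> P p"
  obtains u v where "x = u + v" "u \<in> P (p + 1)" "v \<in> P p \<inter> Q (n - p)"
proof -
  obtain lo where lo: "\<And>p. p \<le> lo \<Longrightarrow> G p = UNIV" by (rule finite_filtration_bounds[OF G]) (rule that)
  \<comment> \<open>Low enough that \<open>Q q\<close> is all of \<open>A\<close>, and at most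
    \<open>n - p\<close> so that the induction meets only indices with \<open>p + q < n\<close>
    before its end.\<close>
  define q where "q = min lo (n - p)"
  have "A \<subseteq> Q q" using lo[of q] G_Q[of q] by (auto simp: q_def)
  then have x: "x \<in> P p \<inter> Q q" using assms P_A by blast
  have "q \<le> n - p" by (simp add: q_def)
  then have "\<forall>x\<in>P p \<inter> Q q. \<exists>u v. x = u + v \<and> u \<in> P (p + 1) \<and> v \<in> P p \<inter> Q (n - p)"
  proof (induction rule: dec_int_induct)
    case top
    show ?case using cplx.subspace_0[OF P_sub] by (metis add_0)
  next
    case (step q)
    show ?case
    proof
      fix x assume x: "x \<in> P p \<inter> Q q"
      have "p + q \<noteq> n" using step by simp
      then obtain u v where uv: "x = u + v" "u \<in> P (p + 1) \<inter> Q q" "v \<in> P p \<inter> Q (q + 1)"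
        using x by (rule Int_step)
      then obtain u' v' where "v = u' + v'" "u' \<in> P (p + 1)" "v' \<in> P p \<inter> Q (n - p)"
        using step.IH by blast
      then show "\<exists>u v. x = u + v \<and> u \<in> P (p + 1) \<and> v \<in> P p \<inter> Q (n - p)"
        using uv cplx.subspace_add[OF P_sub, of u "p + 1" u']
        by (intro exI[of _ "u + u'"] exI[of _ v']) (auto simp: add.assoc)
    qed
  qed
  then show ?thesis using x that by blast
qed

end

section \<open>Complexification, conjugation and the filtrations of a mixed Hodge structure\<close>

lemma csubspace_complexify:
  assumes "subspace S"
  shows "csubspace (complexify S)"
  unfolding cplx.subspace_def
proof (intro conjI ballI allI)
  show "0 \<in> complexify S"
    using subspace_0[OF assms] by (simp add: complexify_def zero_prod_def)
next
  fix x y assume "x \<in> complexify S" "y \<in> complexify S"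
  then show "x + y \<in> complexify S"
    using assms by (auto simp: complexify_def subspace_add)
next
  fix a x assume "x \<in> complexify S"
  then show "cscale a x \<in> complexify S"
    using assms by (auto simp: complexify_def cscale_def subspace_add subspace_diff subspace_scale)
qed

lemma cconj_add: "cconj (x + y) = cconj x + cconj y"
  and cconj_cconj [simp]: "cconj (cconj x) = x"
  and cconj_zero [simp]: "cconj 0 = 0"
  and cconj_cscale: "cconj (cscale a x) = cscale (cnj a) (cconj x)"
  by (simp_all add: cconj_def cscale_def prod_eq_iff)

lemma csubspace_cconj_image:
  assumes "csubspace A"
  shows "csubspace (cconj ` A)"
  unfolding cplx.subspace_def
proof (intro conjI ballI allI)
  show "0 \<in> cconj ` A"
    using cplx.subspace_0[OF assms] by (force intro: image_eqI[of _ _ 0])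
next
  fix x y assume "x \<in> cconj ` A" "y \<in> cconj ` A"
  then show "x + y \<in> cconj ` A"
    using cplx.subspace_add[OF assms] by (auto simp: cconj_add[symmetric] simp del: split_paired_All)
next
  fix a x assume "x \<in> cconj ` A"
  then obtain y where "x = cconj y" "y \<in> A" by blast
  then have "cscale a x = cconj (cscale (cnj a) y)" "cscale (cnj a) y \<in> A"
    using cplx.subspace_scale[OF assms] by (simp_all add: cconj_cscale)
  then show "cscale a x \<in> cconj ` A" by blast
qed

lemma cconj_image_UNIV: "cconj ` UNIV = UNIV"
  by (metis cconj_cconj surjI)

lemma mem_hodge_conj: "u \<in> hodge_conj H p \<longleftrightarrow> cconj u \<in> hodge H p"
  unfolding hodge_conj_def by (metis cconj_cconj image_iff)

lemma real_parts_generate: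
  assumes "csubspace A" "(fst z, 0) \<in> A" "(snd z, 0) \<in> A"
  shows "z \<in> A"
proof -
  have "z = (fst z, 0) + cscale \<i> (snd z, 0)" by (simp add: cscale_def prod_eq_iff)
  also have "\<dots> \<in> A" using assms by (intro cplx.subspace_add cplx.subspace_scale)
  finally show ?thesis .
qed

lemma real_span_in_csubspace:
  assumes A: "csubspace A" and gen: "\<And>s. s \<in> S \<Longrightarrow> (s, 0) \<in> A" and x: "x \<in> span S"
  shows "(x, 0) \<in> A"
  using x
proof (induction rule: span_induct_alt)
  case base
  show ?case using cplx.subspace_0[OF A] by (simp add: zero_prod_def)
next
  case (step r x y)
  have "(r *\<^sub>R x + y, 0) = cscale (complex_of_real r) (x, 0) + (y, 0)"
    by (simp add: cscale_def)
  then show ?case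
    using step gen by (metis cplx.subspace_add[OF A] cplx.subspace_scale[OF A])
qed

lemma complex_spanning_set:
  fixes S :: "'a::real_vector set"
  assumes "span S = UNIV"
  shows "cspan ((\<lambda>x. (x, 0)) ` S) = UNIV"
proof -
  have "(x, 0) \<in> cspan ((\<lambda>x. (x, 0)) ` S)" for x
    by (rule real_span_in_csubspace[of _ S]) (use assms in \<open>auto intro: cplx.span_base\<close>)
  then show ?thesis
    by (metis UNIV_eq_I cplx.subspace_span real_parts_generate)
qed

lemma mixed_hodge_structure_finite:
  fixes H :: "'a::real_vector filtered_space"
  assumes "mixed_hodge_structure H"
  shows "\<exists>S. finite S \<and> cspan S = (UNIV :: 'a complexified set)"
  using assms complex_spanning_set unfolding mixed_hodge_structure_def by (metis finite_imageI)

lemma mixed_hodge_structure_filtrations: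
  assumes "mixed_hodge_structure H"
  shows "finite_filtration (\<lambda>n. weight_C H (- n))" "finite_filtration (hodge H)"
    "finite_filtration (hodge_conj H)"
proof -
  have W: "\<And>n. subspace (weight H n)" "mono (weight H)"
    and W_bounds: "\<exists>n. weight H n = {0}" "\<exists>n. weight H n = UNIV"
    and F: "\<And>p. csubspace (hodge H p)" "antimono (hodge H)"
    and F_bounds: "\<exists>p. hodge H p = {0}" "\<exists>p. hodge H p = UNIV"
    using assms by (simp_all add: mixed_hodge_structure_def)
  obtain a b where ab: "weight H a = {0}" "weight H b = UNIV" using W_bounds by (elim exE) (rule that)
  show "finite_filtration (\<lambda>n. weight_C H (- n))"
    unfolding finite_filtration_def weight_C_def
  proof (intro conjI allI csubspace_complexify W(1))
    show "antimono (\<lambda>n. complexify (weight H (- n)))"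
    proof (rule antimonoI)
      fix m n :: int assume "m \<le> n"
      then have "weight H (- n) \<subseteq> weight H (- m)" using monoD[OF W(2)] by simp
      then show "complexify (weight H (- n)) \<subseteq> complexify (weight H (- m))"
        by (auto simp: complexify_def)
    qed
    show "\<exists>p. complexify (weight H (- p)) = {0}"
      using ab by (intro exI[of _ "- a"]) (auto simp: complexify_def zero_prod_def)
    show "\<exists>p. complexify (weight H (- p)) = UNIV"
      using ab by (intro exI[of _ "- b"]) (auto simp: complexify_def)
  qed
  show "finite_filtration (hodge H)"
    using F F_bounds by (simp add: finite_filtration_def)
  show "finite_filtration (hodge_conj H)"
    unfolding finite_filtration_def hodge_conj_def
  proof (intro conjI allI csubspace_cconj_image F(1))
    show "antimono (\<lambda>p. cconj ` hodge H p)"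
      using F(2) by (auto simp: antimono_def)
    show "\<exists>p. cconj ` hodge H p = {0}"
      using F_bounds(1) by (metis cconj_zero image_empty image_insert)
    show "\<exists>p. cconj ` hodge H p = UNIV"
      using F_bounds(2) by (metis cconj_image_UNIV)
  qed
qed

section \<open>Bases of a mixed Hodge structure\<close>

lemma split_basis_exists:
  fixes H :: "'a::real_vector filtered_space"
  assumes "mixed_hodge_structure H"
  shows "\<exists>(J :: 'a complexified set) b d r t. split_basis H J b d r t"
proof -
  obtain S where S: "finite S" "cspan S = (UNIV :: 'a complexified set)"
    using mixed_hodge_structure_finite[OF assms] by (elim exE conjE) (rule that)
  note filtrations = mixed_hodge_structure_filtrations[OF assms]
  have zero: "0 \<in> hodge H p" "0 \<in> hodge_conj H p" for p
    using filtrations(2,3) by (simp_all add: finite_filtration_def cplx.subspace_0)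
  obtain B f g c where "coordinates B (\<lambda>x. x) c" "adapted B c (hodge H) f" "adapted B c (hodge_conj H) g"
  \<comment> \<open>With the whole intersection as \<open>Z (a, b)\<close>, the vector itself can be
    the summand in \<open>Z (a, b)\<close>; no relation between the two filtrations is used.\<close>
  proof (rule adapted_basis_exists[OF S filtrations(2,3), of "\<lambda>(a, b). hodge H a \<inter> hodge_conj H b"])
    fix a b x assume "x \<in> hodge H a" "x \<in> hodge_conj H b"
    then show "\<exists>u v w. x = u + v + w \<and> u \<in> hodge H (a + 1) \<and> v \<in> hodge H a \<inter> hodge_conj H (b + 1)
        \<and> w \<in> (case (a, b) of (a, b) \<Rightarrow> hodge H a \<inter> hodge_conj H b)"
      using zero by (intro exI[of _ 0] exI[of _ x]) simp
  qed (simp_all add: that)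
  then show ?thesis unfolding split_basis_def by blast
qed

text \<open>In each graded piece of \<open>W\<close> the classes of type \<open>(p, q)\<close> lift
  both to \<open>F\<close> and to its conjugate. Vectors of the first basis are chosen among lifts
  to \<open>F\<close> that come with such a partner. By choice the partners are only congruent to
  the basis; that they are adapted to \<open>W\<close> and the conjugate of \<open>F\<close> needs a
  separate argument.\<close>

lemma hodge_bases_exist:
  fixes H :: "'a::real_vector filtered_space"
  assumes "mixed_hodge_structure H"
  shows "\<exists>(I :: 'a complexified set) e c e' c' f g. hodge_bases H I e c e' c' f g"
proof -
  obtain S where S: "finite S" "cspan S = (UNIV :: 'a complexified set)"
    using mixed_hodge_structure_finite[OF assms] by (elim exE conjE) (rule that)
  note filtrations = mixed_hodge_structure_filtrations[OF assms]
  define L where "L a = weight_C H (- a)" for a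
  have L: "finite_filtration L" using filtrations(1) by (simp add: L_def[abs_def])
  have L_sub: "csubspace (L a)" for a using L by (simp add: finite_filtration_def)
  have L_anti: "a \<le> b \<Longrightarrow> L b \<subseteq> L a" for a b using L by (auto simp: finite_filtration_def antimono_def)
  have G_sub: "csubspace (hodge_conj H q)" for q using filtrations by (simp add: finite_filtration_def)
  have G_anti: "q \<le> q' \<Longrightarrow> hodge_conj H q' \<subseteq> hodge_conj H q" for q q'
    using filtrations by (auto simp: finite_filtration_def antimono_def)
  have opposed: "opposed_filtrations (hodge H) (hodge_conj H) (L a) (L (a + 1)) (- a)" for a
  proof
    show "L (a + 1) \<subseteq> L a" by (rule L_anti) simp
    fix p q assume "p + q \<noteq> - a"
    then have "zero_subquotient (gr_dec (hodge H) p (gr_dec (hodge_conj H) q (gr_inc (weight_C H) (- a) whole_space)))"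
      using assms by (simp add: mixed_hodge_structure_def)
    then show "zero_subquotient (gr_dec (hodge H) p (gr_dec (hodge_conj H) q (L a, L (a + 1))))"
      by (simp add: gr_inc_def whole_space_def set_plus_zero_subspace L_def)
  qed (use filtrations L_sub in auto)
  \<comment> \<open>\<open>L a\<close> has weight \<open>- a\<close>, so that \<open>b\<close> and
    \<open>- a - b\<close> are the complementary Hodge types. The partner \<open>x'\<close>
    represents the same class modulo lower weight.\<close>
  define Z where "Z = (\<lambda>(a, b). {x \<in> L a \<inter> hodge H b. \<exists>x'\<in>L a \<inter> hodge_conj H (- a - b). x - x' \<in> L (a + 1)})"
  obtain B k f c where B: "coordinates B (\<lambda>x. x) c" and adL: "adapted B c L k"
    and adF: "adapted B c (hodge H) f" and BZ: "\<And>x. x \<in> B \<Longrightarrow> x \<in> Z (k x, f x)"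
  proof (rule adapted_basis_exists[OF S L filtrations(2), of Z])
    show "Z (a, b) \<subseteq> L a \<inter> hodge H b" for a b by (auto simp: Z_def)
    fix a b x assume x: "x \<in> L a" "x \<in> hodge H b"
    interpret opposed_filtrations "hodge H" "hodge_conj H" "L a" "L (a + 1)" "- a" by (rule opposed)
    have "x \<in> P b" using x F_P by auto
    then obtain u v where uv: "x = u + v" "u \<in> P (b + 1)" "v \<in> P b \<inter> Q (- a - b)"
      by (rule decomposition)
    obtain u1 w1 where u: "u = u1 + w1" "u1 \<in> hodge H (b + 1)" "u1 \<in> L a" "w1 \<in> L (a + 1)"
      using uv(2) by (auto simp: P_def elim: set_plus_elim)
    obtain z w2 where z: "v = z + w2" "z \<in> hodge H b" "z \<in> L a" "w2 \<in> L (a + 1)"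
      using uv(3) by (auto simp: P_def elim: set_plus_elim)
    \<comment> \<open>Exchanging \<open>v\<close> for its representative \<open>z\<close> in
      \<open>hodge H b\<close> changes it by an element of \<open>L (a + 1)\<close>, which
      \<open>Q\<close> contains. So \<open>z\<close> keeps its place in \<open>Q\<close> and has a
      partner in the conjugate filtration.\<close>
    have "v - w2 \<in> Q (- a - b)"
      using uv(3) z(4) B_Q by (intro cplx.subspace_diff[OF Q_sub]) auto
    then obtain x' w3 where x': "z = x' + w3" "x' \<in> hodge_conj H (- a - b)" "x' \<in> L a" "w3 \<in> L (a + 1)"
      using z(1) by (auto simp: Q_def elim: set_plus_elim)
    have "z \<in> Z (a, b)" using z x' by (auto simp: Z_def intro!: bexI[of _ x'])
    moreover have "x = (w1 + w2) + u1 + z" using uv u z by simp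
    moreover have "w1 + w2 \<in> L (a + 1)" using u z by (intro cplx.subspace_add L_sub) auto
    ultimately show "\<exists>u v w. x = u + v + w \<and> u \<in> L (a + 1) \<and> v \<in> L a \<inter> hodge H (b + 1) \<and> w \<in> Z (a, b)"
      using u by blast
  qed (rule that)
  interpret coordinates B "\<lambda>x. x" c by fact
  define g where "g x = - k x - f x" for x
  have "\<exists>x'. x' \<in> L (k x) \<inter> hodge_conj H (g x) \<and> x - x' \<in> L (k x + 1)" if "x \<in> B" for x
    using BZ[OF that] by (auto simp: Z_def g_def)
  then obtain e' where e': "\<And>x. x \<in> B \<Longrightarrow> e' x \<in> L (k x)" "\<And>x. x \<in> B \<Longrightarrow> e' x \<in> hodge_conj H (g x)"
    "\<And>x. x \<in> B \<Longrightarrow> x - e' x \<in> L (k x + 1)"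
    by (metis IntE)
  obtain hi where hi: "\<And>p. hi \<le> p \<Longrightarrow> L p = {0}" by (rule finite_filtration_bounds[OF L]) (rule that)
  have zero: "L p \<subseteq> cspan T" if "hi \<le> p" for p T
    using hi[OF that] cplx.span_zero by auto
  have exp: "x = (\<Sum>i\<in>B \<inter> {i. a \<le> k i}. cscale (c i x) i)" if "x \<in> L a" for x a
    using that adL by (intro coord_span_expansion) (simp add: adapted_def)
  \<comment> \<open>The change from \<open>i\<close> to \<open>e' i\<close> is unitriangular with
    respect to \<open>L\<close>: expanding in the old basis and replacing its vectors leaves an
    error in \<open>L (a + 1)\<close>, to which the induction applies.\<close>
  have L_span: "L a \<subseteq> cspan (e' ` (B \<inter> {i. a \<le> k i}))" for a
  proof (cases "a \<le> hi")
    case True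
    then show ?thesis
    proof (induction rule: dec_int_induct)
      case (step a)
      show ?case
      proof
        fix x assume "x \<in> L a"
        then have "x = (\<Sum>i\<in>B \<inter> {i. a \<le> k i}. cscale (c i x) i)" by (rule exp)
        also have "\<dots> = (\<Sum>i\<in>B \<inter> {i. a \<le> k i}. cscale (c i x) (e' i))
            + (\<Sum>i\<in>B \<inter> {i. a \<le> k i}. cscale (c i x) (i - e' i))"
          by (simp add: sum.distrib[symmetric] cplx.scale_right_distrib[symmetric])
        also have "\<dots> \<in> cspan (e' ` (B \<inter> {i. a \<le> k i}))"
        proof (rule cplx.span_add)
          show "(\<Sum>i\<in>B \<inter> {i. a \<le> k i}. cscale (c i x) (e' i)) \<in> cspan (e' ` (B \<inter> {i. a \<le> k i}))"
            by (intro cplx.span_sum cplx.span_scale cplx.span_base) auto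
          have "(\<Sum>i\<in>B \<inter> {i. a \<le> k i}. cscale (c i x) (i - e' i)) \<in> L (a + 1)"
          proof (intro cplx.subspace_sum cplx.subspace_scale L_sub)
            fix i assume "i \<in> B \<inter> {i. a \<le> k i}"
            then show "i - e' i \<in> L (a + 1)" using e'(3)[of i] L_anti[of "a + 1" "k i + 1"] by auto
          qed
          also have "\<dots> \<subseteq> cspan (e' ` (B \<inter> {i. a + 1 \<le> k i}))" by (rule step.IH)
          also have "\<dots> \<subseteq> cspan (e' ` (B \<inter> {i. a \<le> k i}))" by (intro cplx.span_mono) auto
          finally show "(\<Sum>i\<in>B \<inter> {i. a \<le> k i}. cscale (c i x) (i - e' i))
            \<in> cspan (e' ` (B \<inter> {i. a \<le> k i}))" .
        qed
        finally show "x \<in> cspan (e' ` (B \<inter> {i. a \<le> k i}))" .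
      qed
    qed (rule zero, simp)
  qed (rule zero, simp)
  \<comment> \<open>From \<open>x\<close> subtract the part \<open>y\<close> of its expansion at
    weight exactly \<open>- a\<close> and second type at least \<open>q\<close>, written with the
    partners. The remainder lies in \<open>L (a + 1)\<close> by opposedness, and the induction
    continues there.\<close>
  have G_span: "L a \<inter> hodge_conj H q \<subseteq> cspan (e' ` (B \<inter> {i. q \<le> g i}))" for a q
  proof (cases "a \<le> hi")
    case True
    then show ?thesis
    proof (induction rule: dec_int_induct)
      case (step a)
      interpret opposed_filtrations "hodge H" "hodge_conj H" "L a" "L (a + 1)" "- a" by (rule opposed)
      show ?case
      proof
        fix x assume x: "x \<in> L a \<inter> hodge_conj H q"
        let ?R = "B \<inter> {i. a \<le> k i}"
        define h where "h i = (if k i = a \<and> q \<le> g i then e' i else 0)" for i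
        define y where "y = (\<Sum>i\<in>?R. cscale (c i x) (h i))"
        have y_span: "y \<in> cspan (e' ` (B \<inter> {i. q \<le> g i}))"
          unfolding y_def
          by (intro cplx.span_sum cplx.span_scale) (auto simp: h_def cplx.span_zero intro: cplx.span_base)
        have "y \<in> L a \<inter> hodge_conj H q"
          unfolding y_def
        proof (intro cplx.subspace_sum cplx.subspace_scale cplx.subspace_inter L_sub G_sub)
          fix i assume "i \<in> ?R"
          then show "h i \<in> L a \<inter> hodge_conj H q"
            using e'(1,2)[of i] G_anti[of q "g i"] cplx.subspace_0[OF L_sub] cplx.subspace_0[OF G_sub]
            by (auto simp: h_def)
        qed
        then have xy: "x - y \<in> L a \<inter> hodge_conj H q"
          using x by (intro cplx.subspace_diff cplx.subspace_inter L_sub G_sub)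
        have "x - y = (\<Sum>i\<in>?R. cscale (c i x) i) - y" using exp[of x a] x by simp
        also have "\<dots> = (\<Sum>i\<in>?R. cscale (c i x) (i - h i))"
          by (simp add: y_def sum_subtractf[symmetric] cplx.scale_right_diff_distrib[symmetric])
        also have "\<dots> \<in> P (- a - q + 1)"
        proof (intro cplx.subspace_sum cplx.subspace_scale P_sub)
          fix i assume i: "i \<in> ?R"
          \<comment> \<open>A vector not replaced by its partner has larger \<open>k i\<close>,
            hence lies in \<open>L (a + 1)\<close>, or has \<open>k i = a\<close> and
            \<open>g i < q\<close>, which means \<open>f i >= - a - q + 1\<close>. A replaced vector
            contributes only its difference from the partner, again in
            \<open>L (a + 1)\<close>.\<close>
          consider "k i = a" "q \<le> g i" | "k i = a" "g i < q" | "a < k i" using i by force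
          then show "i - h i \<in> P (- a - q + 1)"
          proof cases
            case 1
            then show ?thesis using i e'(3)[of i] B_P by (auto simp: h_def)
          next
            case 2
            then have "i \<in> hodge H (- a - q + 1) \<inter> L a"
              using i adapted_basis_mem[OF adF, of i] adapted_basis_mem[OF adL, of i] by (auto simp: g_def)
            then show ?thesis using 2 F_P by (auto simp: h_def)
          next
            case 3
            then have "i \<in> L (a + 1)" using i adapted_basis_mem[OF adL, of i] by auto
            then show ?thesis using 3 B_P by (auto simp: h_def)
          qed
        qed
        \<comment> \<open>The indices add up to \<open>- a + 1\<close>, one more than the weight, so
          \<open>Int_subset\<close> applies.\<close>
        finally have "x - y \<in> P (- a - q + 1) \<inter> Q q" using xy G_Q by auto
        then have "x - y \<in> L (a + 1)" using Int_subset[of "- a - q + 1" q] by auto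
        then have "x - y \<in> cspan (e' ` (B \<inter> {i. q \<le> g i}))" using step.IH xy by auto
        then have "(x - y) + y \<in> cspan (e' ` (B \<inter> {i. q \<le> g i}))"
          using y_span by (rule cplx.span_add)
        then show "x \<in> cspan (e' ` (B \<inter> {i. q \<le> g i}))" by simp
      qed
    qed (use zero[of hi] in auto)
  qed (use zero[of a] in auto)
  obtain lo where lo: "L lo = UNIV" using L by (auto simp: finite_filtration_def)
  have "cspan (e' ` B) = UNIV"
    using L_span[of lo] lo cplx.span_mono[of "e' ` (B \<inter> {i. lo \<le> k i})" "e' ` B"] by auto
  then obtain c' where c': "coordinates B e' c'"
    using coordinates_of_spanning[OF B] by blast
  interpret e': coordinates B e' c' by (rule c')
  have "adapted B c' L k"
    unfolding adapted_def e'.coord_span_eq_span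
  proof (intro allI equalityI L_span cplx.span_minimal L_sub)
    show "e' ` (B \<inter> {i. a \<le> k i}) \<subseteq> L a" for a
      using e'(1) L_anti by blast
  qed
  moreover have "adapted B c' (hodge_conj H) g"
    unfolding adapted_def e'.coord_span_eq_span
  proof (intro allI equalityI cplx.span_minimal G_sub)
    show "hodge_conj H q \<subseteq> cspan (e' ` (B \<inter> {i. q \<le> g i}))" for q
      using G_span[of lo q] lo by simp
    show "e' ` (B \<inter> {i. q \<le> g i}) \<subseteq> hodge_conj H q" for q
      using e'(2) G_anti by blast
  qed
  moreover have "(\<lambda>i. - (f i + g i)) = k" by (auto simp: g_def)
  moreover have "i - e' i \<in> weight_C H (f i + g i - 1)" if "i \<in> B" for i
    using e'(3)[OF that] by (simp add: g_def L_def)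
  ultimately have "hodge_bases H B (\<lambda>x. x) c e' c' f g"
    using B c' adL adF by (simp add: hodge_bases_def L_def[abs_def])
  then show ?thesis by blast
qed

subsection \<open>Tensor products\<close>

lemma lookup_scaleR: "Poly_Mapping.lookup (r *\<^sub>R m) k = r *\<^sub>R Poly_Mapping.lookup m k"
proof -
  have "finite {i. r *\<^sub>R Poly_Mapping.lookup m i \<noteq> 0}"
    by (rule finite_subset[OF _ finite_lookup[of m]]) auto
  then show ?thesis by (simp add: scaleR_poly_mapping_def)
qed

lemma poly_mapping_in_span_singles:
  fixes m :: "('k, real) poly_mapping"
  shows "m \<in> span (range (\<lambda>k. Poly_Mapping.single k 1))"
proof (induction m rule: update_induct)
  case const
  show ?case by (rule span_zero)
next
  case (update m k r)
  have "Poly_Mapping.update k r m = m + r *\<^sub>R Poly_Mapping.single k 1"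
    using update(1) by (intro poly_mapping_eqI)
      (auto simp: lookup_update lookup_add lookup_scaleR lookup_single when_def in_keys_iff)
  then show ?case
    using update(3) by (simp add: span_add span_scale span_base)
qed

definition free_extension :: "('k \<Rightarrow> 'c::real_vector) \<Rightarrow> ('k, real) poly_mapping \<Rightarrow> 'c" where
  "free_extension \<beta> m = (\<Sum>k\<in>Poly_Mapping.keys m. Poly_Mapping.lookup m k *\<^sub>R \<beta> k)"

lemma free_extension_superset:
  assumes "finite A" "Poly_Mapping.keys m \<subseteq> A"
  shows "free_extension \<beta> m = (\<Sum>k\<in>A. Poly_Mapping.lookup m k *\<^sub>R \<beta> k)"
  unfolding free_extension_def
  by (rule sum.mono_neutral_left) (use assms in \<open>auto simp: in_keys_iff\<close>)

lemma linear_free_extension: "linear (free_extension \<beta>)"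
proof (rule linearI)
  fix m m' :: "('a, real) poly_mapping"
  let ?A = "Poly_Mapping.keys m \<union> Poly_Mapping.keys m'"
  show "free_extension \<beta> (m + m') = free_extension \<beta> m + free_extension \<beta> m'"
    using keys_add[of m m']
    by (simp add: free_extension_superset[of ?A] lookup_add scaleR_add_left sum.distrib)
next
  fix r and m :: "('a, real) poly_mapping"
  have "Poly_Mapping.keys (r *\<^sub>R m) \<subseteq> Poly_Mapping.keys m"
    by (auto simp: in_keys_iff lookup_scaleR)
  then show "free_extension \<beta> (r *\<^sub>R m) = r *\<^sub>R free_extension \<beta> m"
    by (simp add: free_extension_superset[of "Poly_Mapping.keys m"] lookup_scaleR scaleR_sum_right)
qed

lemma free_extension_single: "free_extension \<beta> (Poly_Mapping.single k 1) = \<beta> k"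
  by (simp add: free_extension_def)

text \<open>Linear forms on the quotient can only come from forms on the free space that kill the
  relations. This is the source of all coordinates on tensor products below.\<close>

lemma tensor_universal:
  fixes \<beta> :: "'a::real_vector \<Rightarrow> 'b::real_vector \<Rightarrow> 'c::real_vector"
  assumes "bilinear \<beta>"
  shows "\<exists>T. linear T \<and> (\<forall>x y. T (tensor_mk x y) = \<beta> x y)"
proof -
  let ?E = "free_extension (\<lambda>(x, y). \<beta> x y)"
  interpret E: linear ?E by (rule linear_free_extension)
  have "tensor_relations \<subseteq> {m. ?E m = 0}"
    unfolding tensor_relations_def
    by (auto simp: E.diff E.add E.scale free_extension_single
        bilinear_ladd[OF assms] bilinear_radd[OF assms] bilinear_lmul[OF assms] bilinear_rmul[OF assms])
  then have "span tensor_relations \<subseteq> {m. ?E m = 0}"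
    by (intro span_minimal) (auto simp: subspace_def E.add E.scale E.zero)
  then have E_eq: "?E m = ?E m'" if "tensor_equiv m m'" for m m'
    using that E.diff[of m m'] by (auto simp: tensor_equiv_def)
  \<comment> \<open>\<open>T\<close> evaluates on a chosen representative; by \<open>E_eq\<close>
    the choice does not matter.\<close>
  define T where "T t = ?E (rep_tensor t)" for t :: "('a, 'b) tensor"
  have T: "T (abs_tensor m) = ?E m" for m
    unfolding T_def by (rule E_eq) (rule Quotient3_rep_abs[OF Quotient3_tensor], simp add: tensor_equiv_def span_zero)
  have "linear T"
  proof (rule linearI)
    fix s t show "T (s + t) = T s + T t"
      by (induction s rule: tensor.abs_induct, induction t rule: tensor.abs_induct)
        (simp add: plus_tensor.abs_eq T E.add)
  next
    fix r t show "T (r *\<^sub>R t) = r *\<^sub>R T t"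
      by (induction t rule: tensor.abs_induct) (simp add: scaleR_tensor.abs_eq T E.scale)
  qed
  moreover have "T (tensor_mk x y) = \<beta> x y" for x y
    by (simp add: tensor_mk.abs_eq T free_extension_single)
  ultimately show ?thesis by blast
qed

lemma span_tensor_mk: "t \<in> span (range (\<lambda>(x, y). tensor_mk x y))"
proof (induction t rule: tensor.abs_induct)
  case (1 m)
  have "m \<in> span (range (\<lambda>k. Poly_Mapping.single k 1))"
    by (rule poly_mapping_in_span_singles)
  then show ?case
  proof (induction rule: span_induct_alt)
    case base
    show ?case using span_zero by (simp add: zero_tensor.abs_eq[symmetric])
  next
    case (step r m m')
    then obtain x y where "m = Poly_Mapping.single (x, y) 1" by auto
    then have "abs_tensor (r *\<^sub>R m + m') = r *\<^sub>R tensor_mk x y + abs_tensor m'"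
      by (simp add: plus_tensor.abs_eq[symmetric] scaleR_tensor.abs_eq[symmetric] tensor_mk.abs_eq)
    moreover have "tensor_mk x y \<in> range (\<lambda>(x, y). tensor_mk x y)"
      by (rule range_eqI[of _ _ "(x, y)"]) simp
    ultimately show ?case
      using step(2) by (simp add: span_add span_scale span_base)
  qed
qed

section \<open>Complexified tensor products\<close>

lemmas tensor_mk_simps =
  bilinear_ladd[OF bilinear_tensor_mk] bilinear_radd[OF bilinear_tensor_mk]
  bilinear_lmul[OF bilinear_tensor_mk] bilinear_rmul[OF bilinear_tensor_mk]
  bilinear_lsub[OF bilinear_tensor_mk] bilinear_rsub[OF bilinear_tensor_mk]
  bilinear_lneg[OF bilinear_tensor_mk] bilinear_rneg[OF bilinear_tensor_mk]
  bilinear_lzero[OF bilinear_tensor_mk] bilinear_rzero[OF bilinear_tensor_mk]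

lemma clinear_mapI:
  assumes "\<And>x y. h (x + y) = h x + h y" "\<And>a x. h (cscale a x) = cscale a (h x)"
  shows "module_hom cscale cscale h"
  by (rule module_hom.intro) (auto intro!: module_hom_axioms.intro assms simp: cplx.module_axioms)

lemma ctensor_mk_linear_left: "module_hom cscale cscale (\<lambda>z. ctensor_mk z w)"
  by (rule clinear_mapI)
    (simp_all add: ctensor_mk_def cscale_def prod_eq_iff tensor_mk_simps algebra_simps)

lemma ctensor_mk_linear_right: "module_hom cscale cscale (\<lambda>w. ctensor_mk z w)"
  by (rule clinear_mapI)
    (simp_all add: ctensor_mk_def cscale_def prod_eq_iff tensor_mk_simps algebra_simps)

lemma cconj_ctensor_mk: "cconj (ctensor_mk z w) = ctensor_mk (cconj z) (cconj w)"
  by (simp add: cconj_def ctensor_mk_def tensor_mk_simps)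

lemma ctensor_mk_real: "ctensor_mk (x, 0) (y, 0) = (tensor_mk x y, 0)"
  by (simp add: ctensor_mk_def tensor_mk_simps)

lemma cspan_ctensor_mk:
  fixes u :: "('a::real_vector, 'b::real_vector) tensor complexified"
  shows "u \<in> cspan (range (\<lambda>(z, w). ctensor_mk z w))"
proof (rule real_parts_generate)
  have "(t, 0) \<in> cspan (range (\<lambda>(z, w). ctensor_mk z w))" for t :: "('a, 'b) tensor"
  proof (rule real_span_in_csubspace[OF _ _ span_tensor_mk])
    fix s :: "('a, 'b) tensor" assume "s \<in> range (\<lambda>(x, y). tensor_mk x y)"
    then obtain x y where "s = tensor_mk x y" by auto
    then show "(s, 0) \<in> cspan (range (\<lambda>(z, w). ctensor_mk z w))"
      by (intro cplx.span_base range_eqI[of _ _ "((x, 0), (y, 0))"]) (simp add: ctensor_mk_real)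
  qed simp
  then show "(fst u, 0) \<in> cspan (range (\<lambda>(z, w). ctensor_mk z w))"
    "(snd u, 0) \<in> cspan (range (\<lambda>(z, w). ctensor_mk z w))" by auto
qed simp

lemma clinear_form_real_parts:
  assumes "clinear_form \<phi>"
  shows "\<phi> z = \<phi> (fst z, 0) + \<i> * \<phi> (snd z, 0)"
proof -
  have "z = (fst z, 0) + cscale \<i> (snd z, 0)" by (simp add: cscale_def prod_eq_iff)
  then have "\<phi> z = \<phi> ((fst z, 0) + cscale \<i> (snd z, 0))" by (rule arg_cong)
  then show ?thesis
    by (simp only: module_hom.add[OF assms] module_hom.scale[OF assms])
qed

lemma clinear_form_real_linear:
  assumes "clinear_form \<phi>"
  shows "linear (\<lambda>x. \<phi> (x, 0))"
proof (rule linearI)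
  fix x y show "\<phi> (x + y, 0) = \<phi> (x, 0) + \<phi> (y, 0)"
    using module_hom.add[OF assms, of "(x, 0)" "(y, 0)"] by simp
  fix r show "\<phi> (r *\<^sub>R x, 0) = r *\<^sub>R \<phi> (x, 0)"
    using module_hom.scale[OF assms, of "complex_of_real r" "(x, 0)"] by (simp add: cscale_def scaleR_conv_of_real)
qed

text \<open>The universal property speaks of real bilinear maps only. So the product is restricted
  to real vectors, factored through the tensor product, and extended complex linearly to real and
  imaginary parts.\<close>

lemma clinear_form_tensor:
  fixes \<phi> :: "'a::real_vector complexified \<Rightarrow> complex" and \<psi> :: "'b::real_vector complexified \<Rightarrow> complex"
  assumes \<phi>: "clinear_form \<phi>" and \<psi>: "clinear_form \<psi>"
  shows "\<exists>\<theta>. clinear_form \<theta> \<and> (\<forall>z w. \<theta> (ctensor_mk z w) = \<phi> z * \<psi> w)"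
proof -
  have "bilinear (\<lambda>x y. \<phi> (x, 0) * \<psi> (y, 0))"
    using clinear_form_real_linear[OF \<phi>] clinear_form_real_linear[OF \<psi>]
    by (auto simp: bilinear_def linear_iff algebra_simps)
  then obtain T :: "('a, 'b) tensor \<Rightarrow> complex"
    where T: "linear T" "\<And>x y. T (tensor_mk x y) = \<phi> (x, 0) * \<psi> (y, 0)"
    using tensor_universal by blast
  interpret T: linear T by (rule T)
  let ?\<theta> = "\<lambda>u. T (fst u) + \<i> * T (snd u)"
  have "clinear_form ?\<theta>"
    by (rule clinear_formI)
      (simp_all add: cscale_def T.add T.diff T.scale scaleR_conv_of_real complex_eq_iff algebra_simps)
  moreover have "?\<theta> (ctensor_mk z w) = \<phi> z * \<psi> w" for z w
    unfolding clinear_form_real_parts[OF \<phi>, of z] clinear_form_real_parts[OF \<psi>, of w]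
    by (simp add: ctensor_mk_def T.add T.diff T(2) distrib_left distrib_right complex_eq_iff)
  ultimately show ?thesis by blast
qed

text \<open>The product forms are dual to the product vectors, which settles independence without
  any count of dimensions. Their values on all pure tensors are recorded because
  \<open>adapted_tensor\<close> tests generators that are not basis vectors.\<close>

lemma coordinates_tensor:
  fixes b :: "'i \<Rightarrow> 'a::real_vector complexified" and b' :: "'j \<Rightarrow> 'b::real_vector complexified"
  assumes "coordinates I b c" "coordinates J b' c'"
  shows "\<exists>d. coordinates (I \<times> J) (\<lambda>(i, j). ctensor_mk (b i) (b' j)) d \<and>
    (\<forall>i\<in>I. \<forall>j\<in>J. \<forall>z w. d (i, j) (ctensor_mk z w) = c i z * c' j w)"
proof -
  interpret b: coordinates I b c by fact
  interpret b': coordinates J b' c' by fact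
  have "\<forall>k\<in>I \<times> J. \<exists>\<theta>. clinear_form \<theta> \<and> (\<forall>z w. \<theta> (ctensor_mk z w) = c (fst k) z * c' (snd k) w)"
    by (intro ballI clinear_form_tensor) (auto intro: b.coord_linear b'.coord_linear)
  then obtain d where lin: "\<And>k. k \<in> I \<times> J \<Longrightarrow> clinear_form (d k)"
    and d: "\<And>k z w. k \<in> I \<times> J \<Longrightarrow> d k (ctensor_mk z w) = c (fst k) z * c' (snd k) w"
    by metis
  let ?e = "\<lambda>(i, j). ctensor_mk (b i) (b' j)"
  \<comment> \<open>The vectors that equal their expansion form a complex subspace, so it is enough
    to expand pure tensors.\<close>
  let ?U = "{u. (\<Sum>k\<in>I \<times> J. cscale (d k u) (?e k)) = u}"
  have "coordinates (I \<times> J) ?e d"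
  proof (rule coordinates.intro)
    show "finite (I \<times> J)" by (simp add: b.finite_index b'.finite_index)
  next
    fix k l assume "k \<in> I \<times> J" "l \<in> I \<times> J"
    then show "d k (?e l) = (if k = l then 1 else 0)"
      by (cases k, cases l) (simp add: d b.coord_basis b'.coord_basis)
  next
    have sub: "csubspace ?U"
      unfolding cplx.subspace_def
      by (auto simp: module_hom.zero[OF lin] module_hom.add[OF lin] module_hom.scale[OF lin]
          cplx.scale_left_distrib sum.distrib cplx.scale_scale[symmetric] cplx.scale_sum_right[symmetric]
          simp del: cplx.scale_scale split_paired_All split_paired_all cong: sum.cong)
    have gen: "ctensor_mk z w \<in> ?U" for z w
    proof -
      have "ctensor_mk z w = ctensor_mk (\<Sum>i\<in>I. cscale (c i z) (b i)) (\<Sum>j\<in>J. cscale (c' j w) (b' j))"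
        by (simp add: b.expansion b'.expansion)
      also have "\<dots> = (\<Sum>i\<in>I. cscale (c i z) (ctensor_mk (b i) (\<Sum>j\<in>J. cscale (c' j w) (b' j))))"
        by (simp only: module_hom.sum[OF ctensor_mk_linear_left] module_hom.scale[OF ctensor_mk_linear_left])
      also have "\<dots> = (\<Sum>i\<in>I. \<Sum>j\<in>J. cscale (c i z * c' j w) (ctensor_mk (b i) (b' j)))"
        by (simp only: module_hom.sum[OF ctensor_mk_linear_right] module_hom.scale[OF ctensor_mk_linear_right]
            cplx.scale_sum_right cplx.scale_scale)
      also have "\<dots> = (\<Sum>k\<in>I \<times> J. cscale (c (fst k) z * c' (snd k) w) (?e k))"
        by (simp add: sum.cartesian_product case_prod_unfold)
      also have "\<dots> = (\<Sum>k\<in>I \<times> J. cscale (d k (ctensor_mk z w)) (?e k))"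
        by (rule sum.cong) (simp_all add: d)
      finally show ?thesis by simp
    qed
    have "cspan (range (\<lambda>(z, w). ctensor_mk z w)) \<subseteq> ?U"
      by (rule cplx.span_minimal[OF _ sub]) (use gen in \<open>simp add: image_subset_iff split: prod.split\<close>)
    then show "(\<Sum>k\<in>I \<times> J. cscale (d k u) (?e k)) = u" for u
      using cspan_ctensor_mk[of u] by blast
  qed (rule lin)
  then show ?thesis using d by force
qed

section \<open>Tensor products of filtrations and of adapted bases\<close>

definition tensor_filtration ::
    "(int \<Rightarrow> 'a::real_vector complexified set) \<Rightarrow> (int \<Rightarrow> 'b::real_vector complexified set) \<Rightarrow>
     int \<Rightarrow> ('a, 'b) tensor complexified set" where
  "tensor_filtration L M p = cspan {ctensor_mk z w | z w i j. i + j = p \<and> z \<in> L i \<and> w \<in> M j}"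

text \<open>If \<open>f i + g j < m + n\<close>, then \<open>f i < m\<close> or
  \<open>g j < n\<close>, so one factor of the coordinate of a generator vanishes. Conversely a
  product vector of type at least \<open>p\<close> is a generator for the splitting
  \<open>p = f i + (p - f i)\<close>.\<close>

lemma adapted_tensor:
  assumes "coordinates I b c" "adapted I c L f" "coordinates J b' c'" "adapted J c' M g"
    and d: "coordinates (I \<times> J) (\<lambda>(i, j). ctensor_mk (b i) (b' j)) d"
      "\<forall>i\<in>I. \<forall>j\<in>J. \<forall>z w. d (i, j) (ctensor_mk z w) = c i z * c' j w"
  shows "adapted (I \<times> J) d (tensor_filtration L M) (\<lambda>(i, j). f i + g j)"
  unfolding adapted_def
proof
  fix p
  interpret d: coordinates "I \<times> J" "\<lambda>(i, j). ctensor_mk (b i) (b' j)" d by fact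
  show "tensor_filtration L M p = coord_span (I \<times> J) d {k. p \<le> (case k of (i, j) \<Rightarrow> f i + g j)}"
  proof
    show "tensor_filtration L M p \<subseteq> coord_span (I \<times> J) d {k. p \<le> (case k of (i, j) \<Rightarrow> f i + g j)}"
      unfolding tensor_filtration_def
    proof (rule cplx.span_minimal[OF _ d.subspace_coord_span], rule subsetI)
      fix u assume "u \<in> {ctensor_mk z w | z w i j. i + j = p \<and> z \<in> L i \<and> w \<in> M j}"
      then obtain z w m n where u: "u = ctensor_mk z w" "m + n = p" and z: "z \<in> L m" and w: "w \<in> M n"
        by blast
      have "d (i, j) (ctensor_mk z w) = 0" if ij: "i \<in> I" "j \<in> J" "f i + g j < m + n" for i j
      proof -
        have "f i < m \<or> g j < n" using ij by linarith
        then have "c i z = 0 \<or> c' j w = 0"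
          using z w ij adapted_mem[OF assms(2)] adapted_mem[OF assms(4)] by meson
        then show ?thesis unfolding d(2)[rule_format, OF ij(1,2)] by (elim disjE) simp_all
      qed
      then show "u \<in> coord_span (I \<times> J) d {k. p \<le> (case k of (i, j) \<Rightarrow> f i + g j)}"
        unfolding u(1) u(2)[symmetric] by (force simp: coord_span_def)
    qed
    show "coord_span (I \<times> J) d {k. p \<le> (case k of (i, j) \<Rightarrow> f i + g j)} \<subseteq> tensor_filtration L M p"
    proof (rule d.coord_span_least)
      show "csubspace (tensor_filtration L M p)" by (simp add: tensor_filtration_def)
      fix k assume k: "k \<in> I \<times> J" "k \<in> {k. p \<le> (case k of (i, j) \<Rightarrow> f i + g j)}"
      obtain i j where ij: "k = (i, j)" by (cases k)
      have "b i \<in> L (f i)" "b' j \<in> M (p - f i)"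
        using k ij coordinates.adapted_basis_mem[OF assms(1,2)] coordinates.adapted_basis_mem[OF assms(3,4)]
        by auto
      then have "ctensor_mk (b i) (b' j) \<in> {ctensor_mk z w | z w i j. i + j = p \<and> z \<in> L i \<and> w \<in> M j}"
        by (intro CollectI exI[of _ "b i"] exI[of _ "b' j"] exI[of _ "f i"] exI[of _ "p - f i"]) simp
      then show "(case k of (i, j) \<Rightarrow> ctensor_mk (b i) (b' j)) \<in> tensor_filtration L M p"
        unfolding tensor_filtration_def ij by (simp add: cplx.span_base)
    qed
  qed
qed

lemma hodge_tensor: "hodge (mhs_tensor H K) = tensor_filtration (hodge H) (hodge K)"
  by (simp add: mhs_tensor_def tensor_filtration_def[abs_def])

text \<open>Conjugation is semilinear, but it is an involution that preserves complex subspaces. One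
  inclusion for all \<open>S\<close> therefore gives the other one.\<close>

lemma cconj_cspan: "cconj ` cspan S = cspan (cconj ` S)"
proof
  have *: "cconj ` cspan S \<subseteq> cspan (cconj ` S)" for S :: "'b::real_vector complexified set"
  proof -
    have "cspan S \<subseteq> cconj ` cspan (cconj ` S)"
    proof (rule cplx.span_minimal)
      show "S \<subseteq> cconj ` cspan (cconj ` S)"
        by (metis cconj_cconj cplx.span_base image_eqI subsetI)
    qed (simp add: csubspace_cconj_image)
    then have "cconj ` cspan S \<subseteq> cconj ` cconj ` cspan (cconj ` S)" by (rule image_mono)
    then show ?thesis by (simp add: image_image)
  qed
  show "cconj ` cspan S \<subseteq> cspan (cconj ` S)" by (rule *)
  have "cconj ` cconj ` cspan (cconj ` S) \<subseteq> cconj ` cspan (cconj ` cconj ` S)"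
    by (intro image_mono *)
  then show "cspan (cconj ` S) \<subseteq> cconj ` cspan S" by (simp add: image_image)
qed

lemma hodge_conj_tensor:
  "hodge_conj (mhs_tensor H K) = tensor_filtration (hodge_conj H) (hodge_conj K)"
proof
  fix p
  have "cconj ` {ctensor_mk z w | z w i j. i + j = p \<and> z \<in> hodge H i \<and> w \<in> hodge K j}
      = {ctensor_mk z w | z w i j. i + j = p \<and> z \<in> hodge_conj H i \<and> w \<in> hodge_conj K j}"
    (is "cconj ` ?X = ?Y")
  proof
    show "cconj ` ?X \<subseteq> ?Y"
      by (auto simp: cconj_ctensor_mk hodge_conj_def simp del: split_paired_Ex) blast
    show "?Y \<subseteq> cconj ` ?X"
    proof
      fix u assume "u \<in> ?Y"
      then obtain z w i j where "u = ctensor_mk (cconj z) (cconj w)" "i + j = p" "z \<in> hodge H i" "w \<in> hodge K j"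
        by (auto simp: hodge_conj_def)
      then show "u \<in> cconj ` ?X"
        by (intro image_eqI[of _ _ "ctensor_mk z w"] CollectI exI[of _ z] exI[of _ w] exI[of _ i] exI[of _ j])
          (simp_all add: cconj_ctensor_mk)
    qed
  qed
  then show "hodge_conj (mhs_tensor H K) p = tensor_filtration (hodge_conj H) (hodge_conj K) p"
    by (simp add: hodge_conj_def[of "mhs_tensor H K"] hodge_tensor tensor_filtration_def cconj_cspan)
qed

text \<open>The weights are spans over the reals, the filtration on the right is a span over the
  complex numbers. Real pure tensors are complex ones, and the real and imaginary parts of a complex
  pure tensor are combinations of real ones of the same weight.\<close>

lemma weight_C_tensor:
  assumes "\<And>n. 0 \<in> weight H n" "\<And>n. 0 \<in> weight K n"
  shows "weight_C (mhs_tensor H K) (- p) =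
    tensor_filtration (\<lambda>n. weight_C H (- n)) (\<lambda>n. weight_C K (- n)) p"
proof
  let ?S = "{tensor_mk x y | x y i j. i + j = - p \<and> x \<in> weight H i \<and> y \<in> weight K j}"
  let ?T = "tensor_filtration (\<lambda>n. weight_C H (- n)) (\<lambda>n. weight_C K (- n)) p"
  have W: "weight_C (mhs_tensor H K) (- p) = complexify (span ?S)"
    by (simp add: weight_C_def mhs_tensor_def)
  have T: "csubspace ?T" by (simp add: tensor_filtration_def)
  have real: "(t, 0) \<in> ?T" if "t \<in> span ?S" for t
  proof (rule real_span_in_csubspace[OF T _ that])
    fix s assume "s \<in> ?S"
    then obtain x y i j where s: "s = tensor_mk x y" "i + j = - p" "x \<in> weight H i" "y \<in> weight K j"
      by blast
    then have "ctensor_mk (x, 0) (y, 0) \<in> ?T"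
      unfolding tensor_filtration_def
      by (intro cplx.span_base CollectI exI[of _ "(x, 0)"] exI[of _ "(y, 0)"] exI[of _ "- i"] exI[of _ "- j"])
        (simp add: assms weight_C_def complexify_def)
    then show "(s, 0) \<in> ?T" by (simp add: s ctensor_mk_real)
  qed
  show "weight_C (mhs_tensor H K) (- p) \<subseteq> ?T"
    unfolding W
  proof
    fix u assume "u \<in> complexify (span ?S)"
    then have "fst u \<in> span ?S" "snd u \<in> span ?S" by (simp_all only: complexify_def mem_Times_iff)
    then show "u \<in> ?T" by (rule real_parts_generate[OF T real real])
  qed
  show "?T \<subseteq> weight_C (mhs_tensor H K) (- p)"
    unfolding W tensor_filtration_def
  proof (rule cplx.span_minimal[OF _ csubspace_complexify[OF subspace_span]], rule subsetI)
    fix u assume "u \<in> {ctensor_mk z w | z w i j. i + j = p \<and> z \<in> weight_C H (- i) \<and> w \<in> weight_C K (- j)}"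
    then obtain z w i j where u: "u = ctensor_mk z w" "i + j = p"
      and "z \<in> weight_C H (- i)" "w \<in> weight_C K (- j)"
      by blast
    then have mem: "fst z \<in> weight H (- i)" "snd z \<in> weight H (- i)"
      "fst w \<in> weight K (- j)" "snd w \<in> weight K (- j)"
      by (simp_all add: weight_C_def complexify_def mem_Times_iff)
    have "tensor_mk x y \<in> span ?S" if "x \<in> weight H (- i)" "y \<in> weight K (- j)" for x y
      using that u(2)
      by (intro span_base CollectI exI[of _ x] exI[of _ y] exI[of _ "- i"] exI[of _ "- j"]) simp
    then show "u \<in> complexify (span ?S)"
      using mem by (simp add: u(1) ctensor_mk_def complexify_def span_add span_diff)
  qed
qed

lemma zero_in_weight:
  assumes "coordinates I b c" "adapted I c (\<lambda>n. weight_C H (- n)) k"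
  shows "0 \<in> weight H n"
proof -
  have "0 \<in> weight_C H (- (- n))"
    using cplx.subspace_0[OF coordinates.adapted_subspace[OF assms]] by blast
  then show ?thesis by (simp add: weight_C_def complexify_def zero_prod_def)
qed

lemma split_basis_tensor:
  assumes "split_basis H I b c r t" "split_basis K J b' c' r' t'"
  shows "\<exists>d. split_basis (mhs_tensor H K) (I \<times> J) (\<lambda>(i, j). ctensor_mk (b i) (b' j)) d
    (\<lambda>(i, j). r i + r' j) (\<lambda>(i, j). t i + t' j)"
proof -
  have b: "coordinates I b c" and b': "coordinates J b' c'"
    using assms by (auto simp: split_basis_def)
  have F: "adapted I c (hodge H) r" "adapted J c' (hodge K) r'"
    and G: "adapted I c (hodge_conj H) t" "adapted J c' (hodge_conj K) t'"
    using assms by (auto simp: split_basis_def)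
  obtain d where d: "coordinates (I \<times> J) (\<lambda>(i, j). ctensor_mk (b i) (b' j)) d"
      "\<forall>i\<in>I. \<forall>j\<in>J. \<forall>z w. d (i, j) (ctensor_mk z w) = c i z * c' j w"
    using coordinates_tensor[OF b b'] by (elim exE conjE) (rule that)
  show ?thesis
    unfolding split_basis_def hodge_tensor hodge_conj_tensor
    by (intro exI[of _ d] conjI d(1) adapted_tensor[OF b F(1) b' F(2) d] adapted_tensor[OF b G(1) b' G(2) d])
qed

lemma hodge_bases_tensor:
  assumes "hodge_bases H I e c e' c' f g" "hodge_bases K J b d b' d' r t"
  shows "\<exists>q q'. hodge_bases (mhs_tensor H K) (I \<times> J) (\<lambda>(i, j). ctensor_mk (e i) (b j)) q
    (\<lambda>(i, j). ctensor_mk (e' i) (b' j)) q' (\<lambda>(i, j). f i + r j) (\<lambda>(i, j). g i + t j)"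
proof -
  let ?WH = "\<lambda>n. weight_C H (- n)" and ?WK = "\<lambda>n. weight_C K (- n)"
  have e: "coordinates I e c" "coordinates I e' c'" and b: "coordinates J b d" "coordinates J b' d'"
    and WH: "adapted I c ?WH (\<lambda>i. - (f i + g i))" "adapted I c' ?WH (\<lambda>i. - (f i + g i))"
    and WK: "adapted J d ?WK (\<lambda>j. - (r j + t j))" "adapted J d' ?WK (\<lambda>j. - (r j + t j))"
    and F: "adapted I c (hodge H) f" "adapted J d (hodge K) r"
    and G: "adapted I c' (hodge_conj H) g" "adapted J d' (hodge_conj K) t"
    and diff: "\<And>i. i \<in> I \<Longrightarrow> e i - e' i \<in> weight_C H (f i + g i - 1)"
      "\<And>j. j \<in> J \<Longrightarrow> b j - b' j \<in> weight_C K (r j + t j - 1)"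
    using assms by (auto simp: hodge_bases_def)
  obtain q where q: "coordinates (I \<times> J) (\<lambda>(i, j). ctensor_mk (e i) (b j)) q"
      "\<forall>i\<in>I. \<forall>j\<in>J. \<forall>z w. q (i, j) (ctensor_mk z w) = c i z * d j w"
    using coordinates_tensor[OF e(1) b(1)] by (elim exE conjE) (rule that)
  obtain q' where q': "coordinates (I \<times> J) (\<lambda>(i, j). ctensor_mk (e' i) (b' j)) q'"
      "\<forall>i\<in>I. \<forall>j\<in>J. \<forall>z w. q' (i, j) (ctensor_mk z w) = c' i z * d' j w"
    using coordinates_tensor[OF e(2) b(2)] by (elim exE conjE) (rule that)
  have W: "(\<lambda>n. weight_C (mhs_tensor H K) (- n)) = tensor_filtration ?WH ?WK"
    using zero_in_weight[OF e(1) WH(1)] zero_in_weight[OF b(1) WK(1)] by (intro ext weight_C_tensor)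
  have types: "(\<lambda>k. - ((case k of (i, j) \<Rightarrow> f i + r j) + (case k of (i, j) \<Rightarrow> g i + t j)))
      = (\<lambda>(i, j). - (f i + g i) + - (r j + t j))"
    by auto
  have "(case k of (i, j) \<Rightarrow> ctensor_mk (e i) (b j)) - (case k of (i, j) \<Rightarrow> ctensor_mk (e' i) (b' j))
      \<in> weight_C (mhs_tensor H K) ((case k of (i, j) \<Rightarrow> f i + r j) + (case k of (i, j) \<Rightarrow> g i + t j) - 1)"
    if k_mem: "k \<in> I \<times> J" for k
  proof -
    obtain i j where k: "k = (i, j)" "i \<in> I" "j \<in> J" using k_mem by auto
    let ?n = "f i + g i + (r j + t j) - 1"
    have gen: "ctensor_mk z w \<in> weight_C (mhs_tensor H K) ?n"
      if "z \<in> weight_C H m" "w \<in> weight_C K l" "m + l = ?n" for z w m l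
    proof -
      have "ctensor_mk z w \<in> tensor_filtration ?WH ?WK (- ?n)"
        unfolding tensor_filtration_def using that
        by (intro cplx.span_base CollectI exI[of _ z] exI[of _ w] exI[of _ "- m"] exI[of _ "- l"]) simp
      then show ?thesis using fun_cong[OF W, of "- ?n"] by simp
    qed
    have "e' i \<in> weight_C H (f i + g i)"
      using coordinates.adapted_basis_mem[OF e(2) WH(2) k(2), of "- (f i + g i)"] by (simp add: add.commute)
    moreover have "b j \<in> weight_C K (r j + t j)"
      using coordinates.adapted_basis_mem[OF b(1) WK(1) k(3), of "- (r j + t j)"] by (simp add: add.commute)
    \<comment> \<open>The difference of the two product vectors telescopes into these two terms;
      each has one factor of lowered weight.\<close>
    ultimately have "ctensor_mk (e i - e' i) (b j) \<in> weight_C (mhs_tensor H K) ?n"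
      "ctensor_mk (e' i) (b j - b' j) \<in> weight_C (mhs_tensor H K) ?n"
      using diff k by (auto intro!: gen)
    moreover have "csubspace (weight_C (mhs_tensor H K) ?n)"
      using fun_cong[OF W, of "- ?n"] by (simp add: tensor_filtration_def)
    ultimately have "ctensor_mk (e i - e' i) (b j) + ctensor_mk (e' i) (b j - b' j)
        \<in> weight_C (mhs_tensor H K) ?n"
      by (intro cplx.subspace_add)
    then show ?thesis
      by (simp add: k module_hom.diff[OF ctensor_mk_linear_left] module_hom.diff[OF ctensor_mk_linear_right]
          algebra_simps)
  qed
  then have "hodge_bases (mhs_tensor H K) (I \<times> J) (\<lambda>(i, j). ctensor_mk (e i) (b j)) q
    (\<lambda>(i, j). ctensor_mk (e' i) (b' j)) q' (\<lambda>(i, j). f i + r j) (\<lambda>(i, j). g i + t j)"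
    unfolding hodge_bases_def W types hodge_tensor hodge_conj_tensor
    by (intro conjI ballI q(1) q'(1) adapted_tensor[OF e(1) WH(1) b(1) WK(1) q]
        adapted_tensor[OF e(2) WH(2) b(2) WK(2) q'] adapted_tensor[OF e(1) F(1) b(1) F(2) q]
        adapted_tensor[OF e(2) G(1) b(2) G(2) q'])
  then show ?thesis by blast
qed

subsection \<open>Duals\<close>

text \<open>Identifies the complexified real dual with the complex linear forms;
  \<open>form_hom\<close> is the inverse by \<open>pairing_form_hom\<close> and
  \<open>pairing_eqI\<close>.\<close>

definition pairing :: "('a::real_vector, real) hom complexified \<Rightarrow> 'a complexified \<Rightarrow> complex" where
  "pairing \<phi> z = Complex (fst (chom_apply \<phi> z)) (snd (chom_apply \<phi> z))"

definition form_hom :: "('a::real_vector complexified \<Rightarrow> complex) \<Rightarrow> ('a, real) hom complexified" where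
  "form_hom \<theta> = (Abs_hom (\<lambda>x. Re (\<theta> (x, 0))), Abs_hom (\<lambda>x. Im (\<theta> (x, 0))))"

lemma linear_hom_apply: "linear (hom_apply f)"
  using hom_apply by auto

lemmas hom_apply_simps =
  linear_add[OF linear_hom_apply] linear_diff[OF linear_hom_apply] linear_neg[OF linear_hom_apply]
  linear_scale[OF linear_hom_apply] linear_0[OF linear_hom_apply]
  plus_hom.rep_eq minus_hom.rep_eq uminus_hom.rep_eq scaleR_hom.rep_eq zero_hom.rep_eq

lemma clinear_form_pairing: "clinear_form (pairing \<phi>)"
  by (rule clinear_formI)
    (simp_all add: pairing_def chom_apply_def cscale_def hom_apply_simps complex_eq_iff algebra_simps)

lemma clinear_form_pairing_left: "clinear_form (\<lambda>\<phi>. pairing \<phi> z)"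
  by (rule clinear_formI)
    (simp_all add: pairing_def chom_apply_def cscale_def hom_apply_simps complex_eq_iff algebra_simps)

lemma pairing_form_hom:
  assumes "clinear_form \<theta>"
  shows "pairing (form_hom \<theta>) z = \<theta> z"
proof -
  have "linear (\<lambda>x. Re (\<theta> (x, 0)))" "linear (\<lambda>x. Im (\<theta> (x, 0)))"
    using clinear_form_real_linear[OF assms] by (simp_all add: linear_iff)
  then show ?thesis
    unfolding clinear_form_real_parts[OF assms, of z]
    by (simp add: pairing_def form_hom_def chom_apply_def Abs_hom_inverse complex_eq_iff)
qed

lemma pairing_eqI:
  assumes "\<And>z. pairing \<phi> z = pairing \<psi> z"
  shows "\<phi> = \<psi>"
proof -
  have "hom_apply (fst \<phi>) x = hom_apply (fst \<psi>) x" "hom_apply (snd \<phi>) x = hom_apply (snd \<psi>) x" for x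
    using assms[of "(x, 0)"] by (simp_all add: pairing_def chom_apply_def hom_apply_simps)
  then show ?thesis
    by (metis ext hom_apply_inject prod_eq_iff)
qed

lemma chom_apply_eq_0_iff: "chom_apply \<phi> z = 0 \<longleftrightarrow> pairing \<phi> z = 0"
  by (simp add: pairing_def complex_eq_iff prod_eq_iff)

lemma pairing_cconj: "pairing (cconj \<phi>) (cconj z) = cnj (pairing \<phi> z)"
  by (simp add: pairing_def chom_apply_def cconj_def hom_apply_simps complex_eq_iff)

text \<open>Basis vectors and coordinate forms exchange their roles, evaluation at
  \<open>b i\<close> being the new coordinate.\<close>

lemma coordinates_dual:
  assumes "coordinates I b c"
  shows "coordinates I (\<lambda>i. form_hom (c i)) (\<lambda>i \<phi>. pairing \<phi> (b i))"
proof -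
  interpret coordinates I b c by fact
  show ?thesis
  proof (rule coordinates.intro)
    show "clinear_form (\<lambda>\<phi>. pairing \<phi> (b i))" for i by (rule clinear_form_pairing_left)
    show "pairing (form_hom (c j)) (b i) = (if i = j then 1 else 0)" if "i \<in> I" "j \<in> I" for i j
      using that by (simp add: pairing_form_hom coord_linear coord_basis)
    show "(\<Sum>i\<in>I. cscale (pairing \<phi> (b i)) (form_hom (c i))) = \<phi>" for \<phi>
    proof (rule pairing_eqI)
      fix z
      have "pairing (\<Sum>i\<in>I. cscale (pairing \<phi> (b i)) (form_hom (c i))) z
          = (\<Sum>i\<in>I. pairing \<phi> (b i) * c i z)"
        by (simp add: module_hom.sum[OF clinear_form_pairing_left] module_hom.scale[OF clinear_form_pairing_left]
            pairing_form_hom coord_linear)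
      also have "\<dots> = pairing \<phi> (\<Sum>i\<in>I. cscale (c i z) (b i))"
        by (simp add: module_hom.sum[OF clinear_form_pairing] module_hom.scale[OF clinear_form_pairing] mult.commute)
      finally show "pairing (\<Sum>i\<in>I. cscale (pairing \<phi> (b i)) (form_hom (c i))) z = pairing \<phi> z"
        by (simp add: expansion)
    qed
  qed (rule finite_index)
qed

text \<open>A homomorphism of degree \<open>p\<close> into \<open>tate 0\<close> must kill the step
  \<open>r\<close> of the filtration as soon as \<open>r + p > 0\<close>. The largest such step has
  \<open>r = 1 - p\<close>, whence an annihilator with this shift.\<close>

definition dual_filtration ::
    "(int \<Rightarrow> 'a::real_vector complexified set) \<Rightarrow> int \<Rightarrow> ('a, real) hom complexified set" where
  "dual_filtration L p = {\<phi>. \<forall>z\<in>L (1 - p). pairing \<phi> z = 0}"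

text \<open>Killing \<open>L (1 - p)\<close> means killing the \<open>b i\<close> with
  \<open>f i >= 1 - p\<close>, that is, the coordinates with \<open>- f i < p\<close>.\<close>

lemma adapted_dual:
  assumes "coordinates I b c" "adapted I c L f"
  shows "adapted I (\<lambda>i \<phi>. pairing \<phi> (b i)) (dual_filtration L) (\<lambda>i. - f i)"
  unfolding adapted_def
proof (intro allI equalityI subsetI)
  interpret coordinates I b c by fact
  fix p \<phi>
  {
    assume "\<phi> \<in> dual_filtration L p"
    then show "\<phi> \<in> coord_span I (\<lambda>i \<phi>. pairing \<phi> (b i)) {i. p \<le> - f i}"
      using adapted_basis_mem[OF assms(2)] by (auto simp: coord_span_def dual_filtration_def simp del: split_paired_All)
  next
    assume \<phi>: "\<phi> \<in> coord_span I (\<lambda>i \<phi>. pairing \<phi> (b i)) {i. p \<le> - f i}"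
    have "pairing \<phi> z = 0" if "z \<in> L (1 - p)" for z
    proof -
      have "pairing \<phi> z = pairing \<phi> (\<Sum>i\<in>I \<inter> {i. 1 - p \<le> f i}. cscale (c i z) (b i))"
        using that assms(2) by (intro arg_cong[of _ _ "pairing \<phi>"] coord_span_expansion) (simp add: adapted_def)
      also have "\<dots> = (\<Sum>i\<in>I \<inter> {i. 1 - p \<le> f i}. c i z * pairing \<phi> (b i))"
        by (simp add: module_hom.sum[OF clinear_form_pairing] module_hom.scale[OF clinear_form_pairing])
      also have "\<dots> = 0"
        using \<phi> by (intro sum.neutral) (auto simp: coord_span_def)
      finally show ?thesis .
    qed
    then show "\<phi> \<in> dual_filtration L p" by (simp add: dual_filtration_def)
  }
qed

lemma hodge_dual:
  assumes "adapted I c (hodge H) f"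
  shows "hodge (mhs_dual H) = dual_filtration (hodge H)"
proof (intro ext set_eqI)
  fix p \<phi>
  have "\<phi> \<in> hodge (mhs_dual H) p \<longleftrightarrow>
      (\<forall>r. \<forall>z\<in>hodge H r. \<not> r + p \<le> 0 \<longrightarrow> chom_apply \<phi> z = 0)"
    by (auto simp: mhs_dual_def mhs_hom_def tate_def)
  also have "\<dots> \<longleftrightarrow> (\<forall>z\<in>hodge H (1 - p). pairing \<phi> z = 0)"
  proof
    assume L: "\<forall>r. \<forall>z\<in>hodge H r. \<not> r + p \<le> 0 \<longrightarrow> chom_apply \<phi> z = 0"
    show "\<forall>z\<in>hodge H (1 - p). pairing \<phi> z = 0"
      using L[rule_format, of _ "1 - p"] by (simp add: chom_apply_eq_0_iff)
  next
    assume R: "\<forall>z\<in>hodge H (1 - p). pairing \<phi> z = 0"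
    show "\<forall>r. \<forall>z\<in>hodge H r. \<not> r + p \<le> 0 \<longrightarrow> chom_apply \<phi> z = 0"
    proof (intro allI ballI impI)
      fix r z assume "z \<in> hodge H r" "\<not> r + p \<le> 0"
      then have "z \<in> hodge H (1 - p)" using adapted_mono[OF assms, of "1 - p" r] by auto
      then show "chom_apply \<phi> z = 0" using R by (simp add: chom_apply_eq_0_iff)
    qed
  qed
  finally show "\<phi> \<in> hodge (mhs_dual H) p \<longleftrightarrow> \<phi> \<in> dual_filtration (hodge H) p"
    by (simp add: dual_filtration_def)
qed

text \<open>Conjugating both arguments of \<open>pairing\<close> conjugates its value, so taking
  annihilators commutes with conjugation.\<close>

lemma hodge_conj_dual:
  assumes "adapted I c (hodge H) f"
  shows "hodge_conj (mhs_dual H) = dual_filtration (hodge_conj H)"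
proof (intro ext set_eqI)
  fix p \<phi>
  have "\<phi> \<in> hodge_conj (mhs_dual H) p \<longleftrightarrow> cconj \<phi> \<in> hodge (mhs_dual H) p"
    by (rule mem_hodge_conj)
  also have "\<dots> \<longleftrightarrow> (\<forall>z\<in>hodge H (1 - p). pairing (cconj (cconj \<phi>)) (cconj z) = 0)"
    unfolding pairing_cconj[of "cconj \<phi>"] by (simp add: hodge_dual[OF assms] dual_filtration_def)
  also have "\<dots> \<longleftrightarrow> \<phi> \<in> dual_filtration (hodge_conj H) p"
    by (simp add: hodge_conj_def dual_filtration_def)
  finally show "\<phi> \<in> hodge_conj (mhs_dual H) p \<longleftrightarrow> \<phi> \<in> dual_filtration (hodge_conj H) p" .
qed

text \<open>In \<open>tate 0\<close> the weight \<open>m - p\<close> is zero exactly for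
  \<open>m < p\<close>, which leaves the annihilator of weight \<open>p - 1\<close>. A complex form
  kills the complexification of a real subspace if and only if its two real components kill that
  subspace.\<close>

lemma weight_C_dual:
  assumes "coordinates I b c" "adapted I c (\<lambda>n. weight_C H (- n)) k"
  shows "weight_C (mhs_dual H) (- p) = dual_filtration (\<lambda>n. weight_C H (- n)) p"
proof (rule set_eqI)
  fix \<phi>
  have zero: "0 \<in> weight H n" for n using zero_in_weight[OF assms] .
  have mono: "weight H m \<subseteq> weight H (p - 1)" if "m \<le> p - 1" for m
  proof -
    have "weight_C H (- (- m)) \<subseteq> weight_C H (- (1 - p))"
      using adapted_mono[OF assms(2), of "1 - p" "- m"] that by simp
    then show ?thesis using zero by (auto simp: weight_C_def complexify_def)
  qed
  have W: "f \<in> weight (mhs_dual H) (- p) \<longleftrightarrow> (\<forall>x\<in>weight H (p - 1). hom_apply f x = 0)" for f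
  proof -
    have "f \<in> weight (mhs_dual H) (- p) \<longleftrightarrow> (\<forall>m. \<forall>x\<in>weight H m. \<not> 0 \<le> m - p \<longrightarrow> hom_apply f x = 0)"
      by (auto simp: mhs_dual_def mhs_hom_def tate_def)
    also have "\<dots> \<longleftrightarrow> (\<forall>x\<in>weight H (p - 1). hom_apply f x = 0)"
    proof
      assume L: "\<forall>m. \<forall>x\<in>weight H m. \<not> 0 \<le> m - p \<longrightarrow> hom_apply f x = 0"
      show "\<forall>x\<in>weight H (p - 1). hom_apply f x = 0" using L[rule_format, of _ "p - 1"] by simp
    next
      assume "\<forall>x\<in>weight H (p - 1). hom_apply f x = 0"
      then show "\<forall>m. \<forall>x\<in>weight H m. \<not> 0 \<le> m - p \<longrightarrow> hom_apply f x = 0"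
        using mono by force
    qed
    finally show ?thesis .
  qed
  have "\<phi> \<in> weight_C (mhs_dual H) (- p) \<longleftrightarrow>
      (\<forall>x\<in>weight H (p - 1). hom_apply (fst \<phi>) x = 0 \<and> hom_apply (snd \<phi>) x = 0)"
    by (auto simp: weight_C_def complexify_def mem_Times_iff W)
  also have "\<dots> \<longleftrightarrow> (\<forall>z\<in>weight_C H (p - 1). pairing \<phi> z = 0)"
  proof
    assume "\<forall>x\<in>weight H (p - 1). hom_apply (fst \<phi>) x = 0 \<and> hom_apply (snd \<phi>) x = 0"
    then show "\<forall>z\<in>weight_C H (p - 1). pairing \<phi> z = 0"
      by (simp add: weight_C_def complexify_def pairing_def chom_apply_def complex_eq_iff)
  next
    assume R: "\<forall>z\<in>weight_C H (p - 1). pairing \<phi> z = 0"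
    show "\<forall>x\<in>weight H (p - 1). hom_apply (fst \<phi>) x = 0 \<and> hom_apply (snd \<phi>) x = 0"
    proof
      fix x assume "x \<in> weight H (p - 1)"
      then have "pairing \<phi> (x, 0) = 0" using R zero by (simp add: weight_C_def complexify_def)
      then show "hom_apply (fst \<phi>) x = 0 \<and> hom_apply (snd \<phi>) x = 0"
        by (simp add: pairing_def chom_apply_def hom_apply_simps complex_eq_iff)
    qed
  qed
  finally show "\<phi> \<in> weight_C (mhs_dual H) (- p) \<longleftrightarrow> \<phi> \<in> dual_filtration (\<lambda>n. weight_C H (- n)) p"
    by (simp add: dual_filtration_def)
qed

lemma split_basis_dual:
  assumes "split_basis H J b d r t"
  shows "split_basis (mhs_dual H) J (\<lambda>j. form_hom (d j)) (\<lambda>j \<phi>. pairing \<phi> (b j)) (\<lambda>j. - r j) (\<lambda>j. - t j)"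
proof -
  have b: "coordinates J b d" and F: "adapted J d (hodge H) r" and G: "adapted J d (hodge_conj H) t"
    using assms by (simp_all add: split_basis_def)
  show ?thesis
    unfolding split_basis_def hodge_dual[OF F] hodge_conj_dual[OF F]
    by (intro conjI coordinates_dual[OF b] adapted_dual[OF b] F G)
qed

lemma hodge_bases_dual:
  assumes "hodge_bases H I e c e' c' f g"
  shows "hodge_bases (mhs_dual H) I (\<lambda>i. form_hom (c i)) (\<lambda>i \<phi>. pairing \<phi> (e i))
    (\<lambda>i. form_hom (c' i)) (\<lambda>i \<phi>. pairing \<phi> (e' i)) (\<lambda>i. - f i) (\<lambda>i. - g i)"
proof -
  let ?W = "\<lambda>n. weight_C H (- n)"
  have e: "coordinates I e c" "coordinates I e' c'"
    and W: "adapted I c ?W (\<lambda>i. - (f i + g i))" "adapted I c' ?W (\<lambda>i. - (f i + g i))"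
    and F: "adapted I c (hodge H) f" and G: "adapted I c' (hodge_conj H) g"
    and diff: "\<And>i. i \<in> I \<Longrightarrow> e i - e' i \<in> weight_C H (f i + g i - 1)"
    using assms by (auto simp: hodge_bases_def)
  interpret e: coordinates I e c by fact
  interpret e': coordinates I e' c' by fact
  have WD: "(\<lambda>n. weight_C (mhs_dual H) (- n)) = dual_filtration ?W"
    by (intro ext weight_C_dual[OF e(1) W(1)])
  have types: "(\<lambda>i. - (- f i + - g i)) = (\<lambda>i. - (- (f i + g i)))" by simp
  have "form_hom (c i) - form_hom (c' i) \<in> weight_C (mhs_dual H) (- f i + - g i - 1)" if i: "i \<in> I" for i
  proof -
    define n where "n = f i + g i"
    \<comment> \<open>Weight \<open>- n - 1\<close> of the dual is the annihilator of weight
      \<open>n\<close>, so the required congruence says that \<open>c i\<close> and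
      \<open>c' i\<close> agree on weight \<open>n\<close>.\<close>
    have "pairing (form_hom (c i) - form_hom (c' i)) z = 0" if z: "z \<in> weight_C H n" for z
    proof -
      let ?K = "I \<inter> {k. - n \<le> - (f k + g k)}"
      \<comment> \<open>For \<open>k\<close> of weight at most \<open>n\<close>, the difference
        \<open>e k - e' k\<close> has weight below that of \<open>i\<close>, where
        \<open>c' i\<close> vanishes. Hence \<open>c' i\<close> takes the same values on these
        \<open>e k\<close> as on \<open>e' k\<close>.\<close>
      have c'_e: "c' i (e k) = (if i = k then 1 else 0)" if k: "k \<in> ?K" for k
      proof -
        have "e k - e' k \<in> ?W (- (f k + g k - 1))" using k diff by simp
        then have "c' i (e k - e' k) = 0"
          using i k adapted_mem[OF W(2), of "e k - e' k" "- (f k + g k - 1)"] by (auto simp: n_def)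
        then show ?thesis using i k by (simp add: e'.coord_diff e'.coord_basis)
      qed
      have "z = (\<Sum>k\<in>?K. cscale (c k z) (e k))"
        using z W(1)[unfolded adapted_def, rule_format, of "- n"] by (intro e.coord_span_expansion) simp
      then have "c' i z = c' i (\<Sum>k\<in>?K. cscale (c k z) (e k))" by (rule arg_cong)
      also have "\<dots> = (\<Sum>k\<in>?K. if i = k then c k z else 0)"
        unfolding e'.coord_sum[OF i] by (rule sum.cong) (simp_all add: e'.coord_scale[OF i] c'_e)
      also have "\<dots> = c i z" using i e.finite_index by (simp add: n_def)
      finally show ?thesis
        using i by (simp add: module_hom.diff[OF clinear_form_pairing_left] pairing_form_hom
            e.coord_linear e'.coord_linear)
    qed
    then have "form_hom (c i) - form_hom (c' i) \<in> dual_filtration ?W (n + 1)"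
      by (simp add: dual_filtration_def)
    then have "form_hom (c i) - form_hom (c' i) \<in> weight_C (mhs_dual H) (- (n + 1))"
      using fun_cong[OF WD, of "n + 1"] by simp
    moreover have "- (n + 1) = - f i + - g i - 1" by (simp add: n_def)
    ultimately show ?thesis by simp
  qed
  then show ?thesis
    unfolding hodge_bases_def WD types hodge_dual[OF F] hodge_conj_dual[OF F]
    by (intro conjI ballI coordinates_dual e adapted_dual[OF e(1)] adapted_dual[OF e(2)] W F G)
qed

subsection \<open>Direct sums and Tate structures\<close>

text \<open>The complexification of a product consists of pairs of pairs grouped by real and
  imaginary part. \<open>cpair\<close>, \<open>cfst\<close> and \<open>csnd\<close> regroup them as
  a pair of complexified vectors.\<close>

definition cpair :: "'a::real_vector complexified \<Rightarrow> 'b::real_vector complexified \<Rightarrow> ('a \<times> 'b) complexified" where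
  "cpair z w = ((fst z, fst w), (snd z, snd w))"

definition cfst :: "('a::real_vector \<times> 'b::real_vector) complexified \<Rightarrow> 'a complexified" where
  "cfst u = (fst (fst u), fst (snd u))"

definition csnd :: "('a::real_vector \<times> 'b::real_vector) complexified \<Rightarrow> 'b complexified" where
  "csnd u = (snd (fst u), snd (snd u))"

lemma cpair_simps [simp]:
  "cfst (cpair z w) = z" "csnd (cpair z w) = w" "cpair (cfst u) (csnd u) = u"
  by (simp_all add: cpair_def cfst_def csnd_def)

lemma cfst_simps: "cfst (u + v) = cfst u + cfst v" "cfst (u - v) = cfst u - cfst v"
    "cfst (cscale a u) = cscale a (cfst u)" "cfst (cconj u) = cconj (cfst u)"
  and csnd_simps: "csnd (u + v) = csnd u + csnd v" "csnd (u - v) = csnd u - csnd v"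
    "csnd (cscale a u) = cscale a (csnd u)" "csnd (cconj u) = cconj (csnd u)"
  by (simp_all add: cfst_def csnd_def cscale_def cconj_def)

lemma cpair_linear_left: "module_hom cscale cscale (\<lambda>z. cpair z 0)"
  and cpair_linear_right: "module_hom cscale cscale (\<lambda>w. cpair 0 w)"
  by (rule clinear_mapI; simp add: cpair_def cscale_def zero_prod_def)+

definition sum_basis ::
    "('i \<Rightarrow> 'a::real_vector complexified) \<Rightarrow> ('j \<Rightarrow> 'b::real_vector complexified) \<Rightarrow> 'i + 'j \<Rightarrow> ('a \<times> 'b) complexified" where
  "sum_basis b b' = case_sum (\<lambda>i. cpair (b i) 0) (\<lambda>j. cpair 0 (b' j))"

definition sum_coords ::
    "('i \<Rightarrow> 'a::real_vector complexified \<Rightarrow> complex) \<Rightarrow> ('j \<Rightarrow> 'b::real_vector complexified \<Rightarrow> complex) \<Rightarrow>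
     'i + 'j \<Rightarrow> ('a \<times> 'b) complexified \<Rightarrow> complex" where
  "sum_coords c c' = case_sum (\<lambda>i u. c i (cfst u)) (\<lambda>j u. c' j (csnd u))"

definition sum_filtration ::
    "(int \<Rightarrow> 'a::real_vector complexified set) \<Rightarrow> (int \<Rightarrow> 'b::real_vector complexified set) \<Rightarrow>
     int \<Rightarrow> ('a \<times> 'b) complexified set" where
  "sum_filtration L M p = {u. cfst u \<in> L p \<and> csnd u \<in> M p}"

lemma coordinates_sum:
  assumes "coordinates I b c" "coordinates J b' c'"
  shows "coordinates (I <+> J) (sum_basis b b') (sum_coords c c')"
proof -
  interpret b: coordinates I b c by fact
  interpret b': coordinates J b' c' by fact
  show ?thesis
  proof (rule coordinates.intro)
    show "finite (I <+> J)" using b.finite_index b'.finite_index by simp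
  next
    fix k assume "k \<in> I <+> J"
    then show "clinear_form (sum_coords c c' k)"
      by (intro clinear_formI; elim PlusE)
        (simp_all add: sum_coords_def cfst_simps csnd_simps b.coord_add b'.coord_add b.coord_scale b'.coord_scale)
  next
    fix k l assume "k \<in> I <+> J" "l \<in> I <+> J"
    then show "sum_coords c c' k (sum_basis b b' l) = (if k = l then 1 else 0)"
      by (elim PlusE) (simp_all add: sum_coords_def sum_basis_def b.coord_basis b'.coord_basis b.coord_zero b'.coord_zero)
  next
    fix u
    have "(\<Sum>k\<in>I <+> J. cscale (sum_coords c c' k u) (sum_basis b b' k))
        = (\<Sum>i\<in>I. cscale (c i (cfst u)) (cpair (b i) 0)) + (\<Sum>j\<in>J. cscale (c' j (csnd u)) (cpair 0 (b' j)))"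
      using b.finite_index b'.finite_index by (simp add: sum.Plus sum_coords_def sum_basis_def)
    also have "\<dots> = cpair (\<Sum>i\<in>I. cscale (c i (cfst u)) (b i)) 0 + cpair 0 (\<Sum>j\<in>J. cscale (c' j (csnd u)) (b' j))"
      by (simp add: module_hom.sum[OF cpair_linear_left] module_hom.scale[OF cpair_linear_left]
          module_hom.sum[OF cpair_linear_right] module_hom.scale[OF cpair_linear_right])
    also have "\<dots> = cpair (cfst u) (csnd u)"
      by (simp only: b.expansion b'.expansion) (simp add: cpair_def del: cpair_simps)
    finally show "(\<Sum>k\<in>I <+> J. cscale (sum_coords c c' k u) (sum_basis b b' k)) = u" by simp
  qed
qed

lemma adapted_sum:
  assumes "adapted I c L f" "adapted J c' M g"
  shows "adapted (I <+> J) (sum_coords c c') (sum_filtration L M) (case_sum f g)"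
  unfolding adapted_def
proof (intro allI set_eqI)
  fix p u
  have "u \<in> sum_filtration L M p \<longleftrightarrow>
      (\<forall>i\<in>I. f i < p \<longrightarrow> c i (cfst u) = 0) \<and> (\<forall>j\<in>J. g j < p \<longrightarrow> c' j (csnd u) = 0)"
    by (simp add: sum_filtration_def adapted_mem[OF assms(1)] adapted_mem[OF assms(2)])
  also have "\<dots> \<longleftrightarrow> (\<forall>k\<in>I <+> J. case_sum f g k < p \<longrightarrow> sum_coords c c' k u = 0)"
    by (simp add: Plus_def ball_Un sum_coords_def)
  also have "\<dots> \<longleftrightarrow> u \<in> coord_span (I <+> J) (sum_coords c c') {k. p \<le> case_sum f g k}"
    unfolding coord_span_def Diff_iff Ball_def mem_Collect_eq not_le by blast
  finally show "u \<in> sum_filtration L M p \<longleftrightarrow> u \<in> coord_span (I <+> J) (sum_coords c c') {k. p \<le> case_sum f g k}" .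
qed

lemma hodge_sum: "hodge (mhs_sum H K) = sum_filtration (hodge H) (hodge K)"
  by (auto simp: mhs_sum_def sum_filtration_def cfst_def csnd_def)

lemma hodge_conj_sum: "hodge_conj (mhs_sum H K) = sum_filtration (hodge_conj H) (hodge_conj K)"
  by (intro ext set_eqI) (simp add: mem_hodge_conj hodge_sum sum_filtration_def cfst_simps csnd_simps)

lemma weight_C_sum: "weight_C (mhs_sum H K) n = sum_filtration (weight_C H) (weight_C K) n"
  by (auto simp: weight_C_def complexify_def mhs_sum_def sum_filtration_def cfst_def csnd_def mem_Times_iff)

lemma split_basis_sum:
  assumes "split_basis H I b c r t" "split_basis K J b' c' r' t'"
  shows "split_basis (mhs_sum H K) (I <+> J) (sum_basis b b') (sum_coords c c') (case_sum r r') (case_sum t t')"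
  using assms unfolding split_basis_def hodge_sum hodge_conj_sum
  by (elim conjE) (intro conjI coordinates_sum adapted_sum)

lemma hodge_bases_sum:
  assumes "hodge_bases H I e c e' c' f g" "hodge_bases K J b d b' d' r t"
  shows "hodge_bases (mhs_sum H K) (I <+> J) (sum_basis e b) (sum_coords c d)
    (sum_basis e' b') (sum_coords c' d') (case_sum f r) (case_sum g t)"
proof -
  have W: "(\<lambda>n. weight_C (mhs_sum H K) (- n)) = sum_filtration (\<lambda>n. weight_C H (- n)) (\<lambda>n. weight_C K (- n))"
    by (auto simp: weight_C_sum sum_filtration_def)
  have types: "(\<lambda>k. - (case_sum f r k + case_sum g t k)) = case_sum (\<lambda>i. - (f i + g i)) (\<lambda>j. - (r j + t j))"
    by (auto split: sum.split)
  have adapted: "coordinates I e c" "coordinates J b d"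
    "adapted I c (\<lambda>n. weight_C H (- n)) (\<lambda>i. - (f i + g i))"
    "adapted J d (\<lambda>n. weight_C K (- n)) (\<lambda>j. - (r j + t j))"
    and diff: "\<And>i. i \<in> I \<Longrightarrow> e i - e' i \<in> weight_C H (f i + g i - 1)"
      "\<And>j. j \<in> J \<Longrightarrow> b j - b' j \<in> weight_C K (r j + t j - 1)"
    using assms by (simp_all add: hodge_bases_def)
  have zero: "0 \<in> weight_C H n" "0 \<in> weight_C K n" for n
    using zero_in_weight[OF adapted(1,3)] zero_in_weight[OF adapted(2,4)]
    by (simp_all add: weight_C_def complexify_def zero_prod_def)
  have "sum_basis e b k - sum_basis e' b' k \<in> weight_C (mhs_sum H K) (case_sum f r k + case_sum g t k - 1)"
    if "k \<in> I <+> J" for k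
    using that diff zero
    by (elim PlusE) (simp_all add: weight_C_sum sum_filtration_def sum_basis_def cfst_simps csnd_simps)
  then show ?thesis
    using assms unfolding hodge_bases_def W types hodge_sum hodge_conj_sum
    by (elim conjE) (intro conjI ballI coordinates_sum adapted_sum; simp)
qed

section \<open>Tate structures\<close>

abbreviation complex_of_pair :: "real \<times> real \<Rightarrow> complex" where
  "complex_of_pair z \<equiv> Complex (fst z) (snd z)"

lemma coordinates_tate: "coordinates {()} (\<lambda>_. (1, 0)) (\<lambda>_. complex_of_pair)"
proof (rule coordinates.intro)
  show "clinear_form complex_of_pair"
    by (rule clinear_formI) (simp_all add: cscale_def complex_eq_iff)
qed (simp_all add: cscale_def complex_eq_iff)

lemma adapted_tate: "adapted {()} (\<lambda>_. complex_of_pair) (\<lambda>p. if p \<le> m then UNIV else {0}) (\<lambda>_. m)"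
  by (auto simp: adapted_def coord_span_def complex_eq_iff prod_eq_iff)

text \<open>The bound \<open>- (- k + - k)\<close> is left in this form to match the weight
  \<open>- (f i + g i)\<close> in \<open>hodge_bases\<close> with both types
  \<open>- k\<close>.\<close>

lemma tate_filtrations:
  "hodge (tate k) = (\<lambda>p. if p \<le> - k then UNIV else {0})"
  "hodge_conj (tate k) = (\<lambda>p. if p \<le> - k then UNIV else {0})"
  "(\<lambda>n. weight_C (tate k) (- n)) = (\<lambda>n. if n \<le> - (- k + - k) then UNIV else {0})"
  by (simp_all add: fun_eq_iff tate_def hodge_conj_def cconj_image_UNIV)
    (simp add: weight_C_def complexify_def tate_def zero_prod_def)

lemma split_basis_tate:
  "split_basis (tate k) {()} (\<lambda>_. (1, 0)) (\<lambda>_. complex_of_pair) (\<lambda>_. - k) (\<lambda>_. - k)"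
  unfolding split_basis_def tate_filtrations by (intro conjI coordinates_tate adapted_tate)

lemma hodge_bases_tate:
  "hodge_bases (tate k) {()} (\<lambda>_. (1, 0)) (\<lambda>_. complex_of_pair) (\<lambda>_. (1, 0)) (\<lambda>_. complex_of_pair)
    (\<lambda>_. - k) (\<lambda>_. - k)"
proof -
  have "0 \<in> weight_C (tate k) n" for n
    by (simp add: weight_C_def complexify_def tate_def zero_prod_def)
  then show ?thesis
    unfolding hodge_bases_def tate_filtrations by (simp add: coordinates_tate adapted_tate)
qed


subsection \<open>The level under tensor products\<close>

lemma sum_square_of_sums:
  fixes x :: "'i \<Rightarrow> real" and y :: "'j \<Rightarrow> real"
  shows "(\<Sum>(i, j)\<in>I \<times> J. (x i + y j)\<^sup>2) =
    real (card J) * (\<Sum>i\<in>I. (x i)\<^sup>2) + 2 * (\<Sum>i\<in>I. x i) * (\<Sum>j\<in>J. y j) + real (card I) * (\<Sum>j\<in>J. (y j)\<^sup>2)"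
proof -
  have "(\<Sum>(i, j)\<in>I \<times> J. (x i + y j)\<^sup>2) = (\<Sum>i\<in>I. \<Sum>j\<in>J. (x i)\<^sup>2 + 2 * (x i * y j) + (y j)\<^sup>2)"
    by (simp add: sum.cartesian_product[symmetric] power2_sum algebra_simps)
  also have "\<dots> = real (card J) * (\<Sum>i\<in>I. (x i)\<^sup>2) + 2 * (\<Sum>i\<in>I. \<Sum>j\<in>J. x i * y j) + real (card I) * (\<Sum>j\<in>J. (y j)\<^sup>2)"
    by (simp add: sum.distrib sum_distrib_left[symmetric] sum_distrib_right[symmetric] mult.commute)
  also have "(\<Sum>i\<in>I. \<Sum>j\<in>J. x i * y j) = (\<Sum>i\<in>I. x i) * (\<Sum>j\<in>J. y j)"
    by (rule sum_product[symmetric])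
  finally show ?thesis by simp
qed

text \<open>First types are compared through \<open>F\<close> with the bases \<open>e\<close> and
  \<open>b\<close>, second types through the conjugate of \<open>F\<close> with \<open>e'\<close>
  and \<open>b\<close>. Only the totals agree; the types themselves may be paired
  differently.\<close>

lemma hodge_split_invariants:
  fixes H :: "'a::real_vector filtered_space"
  assumes "hodge_bases H I e c e' c' f g" "split_basis H J b d r t"
  shows "card I = mhs_dim H" "card J = mhs_dim H"
    "(\<Sum>i\<in>I. real_of_int (f i + g i)) = (\<Sum>j\<in>J. real_of_int (r j + t j))"
proof -
  have e: "coordinates I e c" "coordinates I e' c'" and b: "coordinates J b d"
    and F: "adapted I c (hodge H) f" "adapted J d (hodge H) r"
    and G: "adapted I c' (hodge_conj H) g" "adapted J d (hodge_conj H) t"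
    using assms by (simp_all add: hodge_bases_def split_basis_def)
  show "card I = mhs_dim H" "card J = mhs_dim H"
    using coordinates.dim_eq_card[OF e(1)] coordinates.dim_eq_card[OF b] by (simp_all add: mhs_dim_def)
  show "(\<Sum>i\<in>I. real_of_int (f i + g i)) = (\<Sum>j\<in>J. real_of_int (r j + t j))"
    using sum_types_unique[OF e(1) F(1) b F(2)] sum_types_unique[OF e(2) G(1) b G(2)]
    by (simp add: sum.distrib)
qed

text \<open>Expanding the squares leaves the two levels, multiplied by cardinalities that equal the
  dimensions, and cross terms that cancel by \<open>hodge_split_invariants\<close>. The assumptions
  are bases, so that the explicit ones of \<open>tate k\<close> can be inserted.\<close>

lemma splitting_level_tensor:
  assumes H: "hodge_bases H I e c e' c' f g" "split_basis H J b d r t"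
    and K: "hodge_bases K I' u v u' v' f' g'" "split_basis K J' z w r' t'"
  shows "splitting_level (mhs_tensor H K) =
    real (mhs_dim K) * splitting_level H + real (mhs_dim H) * splitting_level K"
proof -
  obtain q q' where hb: "hodge_bases (mhs_tensor H K) (I \<times> I') (\<lambda>(i, j). ctensor_mk (e i) (u j)) q
      (\<lambda>(i, j). ctensor_mk (e' i) (u' j)) q' (\<lambda>(i, j). f i + f' j) (\<lambda>(i, j). g i + g' j)"
    using hodge_bases_tensor[OF H(1) K(1)] by (elim exE) (rule that)
  obtain p where sb: "split_basis (mhs_tensor H K) (J \<times> J') (\<lambda>(i, j). ctensor_mk (b i) (z j)) p
      (\<lambda>(i, j). r i + r' j) (\<lambda>(i, j). t i + t' j)"
    using split_basis_tensor[OF H(2) K(2)] by (elim exE) (rule that)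
  have square: "(\<Sum>k\<in>A \<times> B. (real_of_int ((case k of (i, j) \<Rightarrow> m i + m' j) + (case k of (i, j) \<Rightarrow> n i + n' j)))\<^sup>2)
      = (\<Sum>(i, j)\<in>A \<times> B. (real_of_int (m i + n i) + real_of_int (m' j + n' j))\<^sup>2)"
    for A :: "'x set" and B :: "'y set" and m m' n n'
    by (rule sum.cong) (auto simp: algebra_simps)
  note inv = hodge_split_invariants[OF H] hodge_split_invariants[OF K]
  show ?thesis
    unfolding splitting_level_eq[OF hb sb] splitting_level_eq[OF H] splitting_level_eq[OF K]
      square sum_square_of_sums inv
    by (simp only: algebra_simps)
qed

theorem mainTheorem7:
  fixes H :: "'a::real_vector filtered_space"
    and H' :: "'b::real_vector filtered_space"
  assumes "mixed_hodge_structure H"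
    and "mixed_hodge_structure H'"
  shows "(\<forall>k::int. splitting_level (mhs_tensor H (tate k)) = splitting_level H)
    \<and> splitting_level (mhs_dual H) = splitting_level H
    \<and> splitting_level (mhs_sum H H') = splitting_level H + splitting_level H'
    \<and> splitting_level (mhs_tensor H H') =
        real (mhs_dim H') * splitting_level H + real (mhs_dim H) * splitting_level H'"
proof -
  obtain I :: "'a complexified set" and e c e' c' f g where hb: "hodge_bases H I e c e' c' f g"
    using hodge_bases_exist[OF assms(1)] by (elim exE) (rule that)
  obtain J :: "'a complexified set" and b d r t where sb: "split_basis H J b d r t"
    using split_basis_exists[OF assms(1)] by (elim exE) (rule that)
  obtain I' :: "'b complexified set" and u v u' v' f' g' where hb': "hodge_bases H' I' u v u' v' f' g'"
    using hodge_bases_exist[OF assms(2)] by (elim exE) (rule that)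
  obtain J' :: "'b complexified set" and z w r' t' where sb': "split_basis H' J' z w r' t'"
    using split_basis_exists[OF assms(2)] by (elim exE) (rule that)
  \<comment> \<open>Both bases of \<open>tate k\<close> consist of one vector of the same type, so
    the level is 0 and the twist becomes a special case of the tensor product.\<close>
  have tate: "splitting_level (tate k) = 0" "mhs_dim (tate k) = 1" for k
    using hodge_split_invariants(1)[OF hodge_bases_tate split_basis_tate]
    by (simp_all add: splitting_level_eq[OF hodge_bases_tate split_basis_tate])
  have "splitting_level (mhs_tensor H (tate k)) = splitting_level H" for k
    using splitting_level_tensor[OF hb sb hodge_bases_tate split_basis_tate] by (simp add: tate)
  moreover have "splitting_level (mhs_dual H) = splitting_level H"
  proof -
    \<comment> \<open>Dualizing negates both types, which the square does not see.\<close>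
    have "(real_of_int (- m + - n))\<^sup>2 = (real_of_int (m + n))\<^sup>2" for m n
      by (simp add: power2_eq_square algebra_simps)
    then show ?thesis
      unfolding splitting_level_eq[OF hb sb] splitting_level_eq[OF hodge_bases_dual[OF hb] split_basis_dual[OF sb]]
      by simp
  qed
  moreover have "splitting_level (mhs_sum H H') = splitting_level H + splitting_level H'"
  proof -
    have "finite I" "finite J" "finite I'" "finite J'"
      using hb sb hb' sb' by (auto simp: hodge_bases_def split_basis_def coordinates.finite_index)
    then show ?thesis
      unfolding splitting_level_eq[OF hb sb] splitting_level_eq[OF hb' sb']
        splitting_level_eq[OF hodge_bases_sum[OF hb hb'] split_basis_sum[OF sb sb']]
      by (simp add: sum.Plus) (simp add: field_simps)
  qed
  moreover have "splitting_level (mhs_tensor H H') =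
      real (mhs_dim H') * splitting_level H + real (mhs_dim H) * splitting_level H'"
    by (rule splitting_level_tensor[OF hb sb hb' sb'])
  ultimately show ?thesis by blast
qed

end
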